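(* Let $\mathcal{C},\mathcal{C}'\subseteq\mathbb{F}_2((z))^n$ be two one-dimensional convolutional codes over $\mathbb{F}_2$. If $\bar{\Lambda}(\mathcal{C})=\bar{\Lambda}(\mathcal{C}')$, then $\bar{\Lambda}(\mathcal{C}^{\perp})=\bar{\Lambda}(\mathcal{C}'^{\perp})$, where $\bar{\Lambda}$ denotes the generalized adjacency matrix and $\perp$ the dual code.
   Context: Let $\mathbb{F}$ be a finite field with $q$ elements (here $\mathbb{F}=\mathbb{F}_2$, $q=2$). **Codes.** A matrix $G\in\mathbb{F}[z]^{k\times n}$ is *basic* if it has a right inverse in $\mathbb{F}[z]^{n\times k}$. A *convolutional code* of dimension $k$ is a subspace $\mathcal{C}=\operatorname{im}G=\{uG\mid u\in\mathbb{F}((z))^k\}$ of $\mathbb{F}((z))^n$ with $G\in\mathbb{F}[z]^{k\times n}$ basic; such a $G$ is called a *generator matrix*. The *overall constraint length* of $\mathcal{C}$ is the maximal degree of the $k\times k$ minors of $G$; it depends only on $\mathcal{C}$. A generator matrix is *minimal* if the sum of its row degrees (the degree of a row being the maximal degree of its entries) equals the overall constraint length. Every code has a minimal generator matrix. The *dual* of a code $\mathcal{C}\subseteq\mathbb{F}((z))^n$ is $\mathcal{C}^\perp=\{w\in\mathbb{F}((z))^n\mid \sum_{i=1}^n v_iw_i=0\text{ for all }v\in\mathcal{C}\}$; it is again a convolutional code (of dimension $n-k$; for $n=k$ it is the zero code, whose generalized adjacency matrix is the $1\times 1$ zero matrix). **Controller canonical form.** Let $G=(g_{ij})\in\mathbb{F}[z]^{k\times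 n}$ be a minimal generator matrix with row degrees $\gamma_1,\dots,\gamma_k$, $\gamma=\sum_i\gamma_i$, and $g_{ij}=\sum_{\nu=0}^{\gamma_i}g_{ij}^{(\nu)}z^\nu$. For each $i$ let $A_i\in\mathbb{F}^{\gamma_i\times\gamma_i}$ have ones on the first superdiagonal and zeros elsewhere, $B_i=(1,0,\dots,0)\in\mathbb{F}^{1\times\gamma_i}$, and let $C_i\in\mathbb{F}^{\gamma_i\times n}$ have $\nu$-th row $(g_{i1}^{(\nu)},\dots,g_{in}^{(\nu)})$, $\nu=1,\dots,\gamma_i$. Put $A=\operatorname{diag}(A_1,\dots,A_k)\in\mathbb{F}^{\gamma\times\gamma}$, $B=\operatorname{diag}(B_1,\dots,B_k)\in\mathbb{F}^{k\times\gamma}$ (block diagonal), let $C\in\mathbb{F}^{\gamma\times n}$ be $C_1,\dots,C_k$ stacked, and $D=(g_{ij}^{(0)})\in\mathbb{F}^{k\times n}$. If $\gamma_i=0$, the corresponding blocks are missing and the $i$-th row of $B$ is zero. **Adjacency matrix.** Let $s=q^\gamma$ and order the state space $\mathbb{F}^\gamma=\{X_0,\dots,X_{s-1}\}$ (row vectors) with $X_0=0$. With $\operatorname{wt}$ the Hamming weight on $\mathbb{F}^n$, for $i,j\in\{0,\dots,s-1\}$ and $\alpha\in\{0,\dots,n\}$ put $\lambda_{i,j}^{(\alpha)}=\#\{u\in\mathbb{F}^k\mid X_j=X_iA+uB,\ \operatorname{wt}(X_iC+uD)=\alpha\}$, except that $\lambda_{0,0}^{(0)}:=0$. The adjacency matrix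 of $G$ is $\Lambda_G=\big(\sum_{\alpha=0}^n\lambda_{i,j}^{(\alpha)}W^\alpha\big)_{i,j=0,\dots,s-1}\in\mathbb{Q}[W]^{s\times s}$. If $\gamma=0$ (block code) the state space is $\{0\}$ and $\Lambda_G=\sum_{u\in\mathbb{F}^k\setminus\{0\}}W^{\operatorname{wt}(uD)}$ is a $1\times1$ matrix. **Generalized adjacency matrix.** Let $\mathcal{G}$ be the group of permutation matrices $\Pi\in GL_s(\mathbb{Q})$ with $\Pi_{0,0}=1$ (indices running from $0$ to $s-1$). For $\Lambda\in\mathbb{Q}[W]^{s\times s}$ put $\overline{\Lambda}=\{\Pi\Lambda\Pi^{-1}\mid\Pi\in\mathcal{G}\}$. The generalized adjacency matrix of $\mathcal{C}$ is $\bar{\Lambda}(\mathcal{C}):=\overline{\Lambda_G}$ for any minimal generator matrix $G$ of $\mathcal{C}$ and any ordering of states with $X_0=0$; it does not depend on these choices. *)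

theory Defs
  imports
    "HOL-Library.Z2"
    "HOL-Library.Cardinality"
    "HOL-Computational_Algebra.Formal_Laurent_Series"
    "HOL-Computational_Algebra.Polynomial_FPS"
    "Jordan_Normal_Form.Determinant"
    "Jordan_Normal_Form.DL_Submatrix"
begin

text \<open>
  Matrices and vectors are those of \<open>Jordan_Normal_Form.Matrix\<close>; all indices start at 0. The field
  with two elements is the type \<open>bit\<close>, and \<open>F((z))\<close> is the type of formal Laurent series over \<open>F\<close>.
\<close>

instance bit :: finite
  by standard (metis (full_types) bit_not_one_iff finite.simps finite_subset insertCI subsetI)

text \<open>Vectors act as rows from the left, whereas the library vectors are columns.\<close>

abbreviation row_mult :: "'a :: comm_semiring_0 vec \<Rightarrow> 'a mat \<Rightarrow> 'a vec" (infixl \<open>\<^bold>*\<close> 70) where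
  "x \<^bold>* M \<equiv> transpose_mat M *\<^sub>v x"

definition hamming_weight :: "'a :: zero vec \<Rightarrow> nat" where
  "hamming_weight v = card {i. i < dim_vec v \<and> v $ i \<noteq> 0}"


section \<open>Convolutional codes\<close>

definition basic_mat :: "'a :: field poly mat \<Rightarrow> bool" where
  "basic_mat G \<longleftrightarrow> (\<exists>H \<in> carrier_mat (dim_col G) (dim_row G). G * H = 1\<^sub>m (dim_row G))"

definition fls_of_poly :: "'a :: field poly \<Rightarrow> 'a fls" where
  "fls_of_poly p = fps_to_fls (fps_of_poly p)"

definition im_mat :: "'a :: field poly mat \<Rightarrow> 'a fls vec set" where
  "im_mat G = {u \<^bold>* map_mat fls_of_poly G | u. u \<in> carrier_vec (dim_row G)}"

definition generator_matrix :: "'a :: field poly mat \<Rightarrow> 'a fls vec set \<Rightarrow> bool" where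
  "generator_matrix G C \<longleftrightarrow> basic_mat G \<and> C = im_mat G"

definition convolutional_code :: "nat \<Rightarrow> nat \<Rightarrow> 'a :: field fls vec set \<Rightarrow> bool" where
  "convolutional_code n k C \<longleftrightarrow> (\<exists>G \<in> carrier_mat k n. generator_matrix G C)"

text \<open>
  This value depends only on the code \<open>im_mat G\<close>, provided that \<open>G\<close> is basic. For a matrix without rows the only
  minor is the empty determinant 1, so that the value is 0.
\<close>

definition overall_constraint_length :: "'a :: field poly mat \<Rightarrow> nat" where
  "overall_constraint_length G =
     Max {degree (det (submatrix G UNIV J)) | J. J \<subseteq> {..<dim_col G} \<and> card J = dim_row G}"

definition row_degree :: "'a :: field poly mat \<Rightarrow> nat \<Rightarrow> nat" where
  "row_degree G i = Max {degree (G $$ (i, j)) | j. j < dim_col G}"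

definition total_row_degree :: "'a :: field poly mat \<Rightarrow> nat" where
  "total_row_degree G = (\<Sum>i<dim_row G. row_degree G i)"

definition minimal_generator_matrix :: "'a :: field poly mat \<Rightarrow> 'a fls vec set \<Rightarrow> bool" where
  "minimal_generator_matrix G C \<longleftrightarrow>
     generator_matrix G C \<and> total_row_degree G = overall_constraint_length G"

definition dual_code :: "nat \<Rightarrow> 'a :: field fls vec set \<Rightarrow> 'a fls vec set" where
  "dual_code n C = {w \<in> carrier_vec n. \<forall>v \<in> C. v \<bullet> w = 0}"


section \<open>Controller canonical form\<close>

text \<open>
  A block \<open>B\<^sub>i\<close> with row degree 0 is a \<open>1 \<times> 0\<close> matrix, so it contributes a zero row to the block
  diagonal matrix \<open>B\<close> and no column.
\<close>

definition ccf_A :: "'a :: field poly mat \<Rightarrow> 'a mat" where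
  "ccf_A G = diag_block_mat (map (\<lambda>i. mat (row_degree G i) (row_degree G i)
     (\<lambda>(\<mu>, \<nu>). if \<nu> = Suc \<mu> then 1 else 0)) [0..<dim_row G])"

definition ccf_B :: "'a :: field poly mat \<Rightarrow> 'a mat" where
  "ccf_B G = diag_block_mat (map (\<lambda>i. mat 1 (row_degree G i)
     (\<lambda>(_, \<nu>). if \<nu> = 0 then 1 else 0)) [0..<dim_row G])"

text \<open>Row \<open>\<nu>\<close> of the block \<open>C\<^sub>i\<close>, counted from 0, consists of the coefficients of \<open>z^(\<nu> + 1)\<close>.\<close>

definition ccf_C :: "'a :: field poly mat \<Rightarrow> 'a mat" where
  "ccf_C G = mat_of_rows (dim_col G) (concat (map (\<lambda>i.
     rows (mat (row_degree G i) (dim_col G) (\<lambda>(\<nu>, j). coeff (G $$ (i, j)) (Suc \<nu>))))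
     [0..<dim_row G]))"

definition ccf_D :: "'a :: field poly mat \<Rightarrow> 'a mat" where
  "ccf_D G = map_mat (\<lambda>p. coeff p 0) G"


section \<open>Adjacency matrices\<close>

text \<open>An ordering \<open>X\<^sub>0, \<dots>, X\<^sub>s\<^sub>-\<^sub>1\<close> of the state space with \<open>X\<^sub>0 = 0\<close>; the values \<open>X i\<close> for \<open>i \<ge> s\<close>
  are irrelevant.\<close>

definition state_ordering :: "nat \<Rightarrow> (nat \<Rightarrow> 'a :: {field, finite} vec) \<Rightarrow> bool" where
  "state_ordering \<gamma> X \<longleftrightarrow> bij_betw X {..<CARD('a) ^ \<gamma>} (carrier_vec \<gamma>) \<and> X 0 = 0\<^sub>v \<gamma>"

definition transition_count ::
    "'a :: {field, finite} poly mat \<Rightarrow> (nat \<Rightarrow> 'a vec) \<Rightarrow> nat \<Rightarrow> nat \<Rightarrow> nat \<Rightarrow> nat" where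
  "transition_count G X i j \<alpha> =
     (if i = 0 \<and> j = 0 \<and> \<alpha> = 0 then 0
      else card {u \<in> carrier_vec (dim_row G).
             X j = X i \<^bold>* ccf_A G + u \<^bold>* ccf_B G \<and>
             hamming_weight (X i \<^bold>* ccf_C G + u \<^bold>* ccf_D G) = \<alpha>})"

text \<open>
  The type \<open>rat poly\<close> is \<open>\<rat>[W]\<close>. If all row degrees are 0, the correction at \<open>i = j = \<alpha> = 0\<close> removes
  precisely the contribution of \<open>u = 0\<close>, so that block codes need no separate case.
\<close>

definition adjacency_matrix ::
    "'a :: {field, finite} poly mat \<Rightarrow> (nat \<Rightarrow> 'a vec) \<Rightarrow> rat poly mat" where
  "adjacency_matrix G X =
     (let s = CARD('a) ^ total_row_degree G
      in mat s s (\<lambda>(i, j). \<Sum>\<alpha>\<le>dim_col G. monom (of_nat (transition_count G X i j \<alpha>)) \<alpha>))"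

definition perm_mat_group :: "nat \<Rightarrow> rat mat set" where
  "perm_mat_group s =
     {P. \<exists>\<pi>. \<pi> permutes {..<s} \<and> P = mat s s (\<lambda>(i, j). if i = \<pi> j then 1 else 0) \<and> P $$ (0, 0) = 1}"

definition perm_conj_class :: "rat poly mat \<Rightarrow> rat poly mat set" where
  "perm_conj_class L =
     {map_mat (\<lambda>c. [:c:]) P * L * map_mat (\<lambda>c. [:c:]) Q | P Q.
        P \<in> perm_mat_group (dim_row L) \<and> Q \<in> carrier_mat (dim_row L) (dim_row L) \<and>
        inverts_mat P Q \<and> inverts_mat Q P}"

text \<open>
  The class does not depend on the choice of the minimal generator matrix and of the ordering of the
  states, and every convolutional code has a minimal generator matrix; the description operator
  therefore returns the common value for all choices. The matrix without rows is admitted as a generator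
  matrix of the zero code, to which the definition assigns the class of the \<open>1 \<times> 1\<close> zero matrix.
\<close>

definition generalized_adjacency_matrix ::
    "'a :: {field, finite} fls vec set \<Rightarrow> rat poly mat set" where
  "generalized_adjacency_matrix C =
     (SOME L. \<exists>G X. minimal_generator_matrix G C \<and> state_ordering (total_row_degree G) X \<and>
        L = perm_conj_class (adjacency_matrix G X))"

end

theory Submission
  imports Defs
begin

text \<open>
  For a one-dimensional binary code of constraint length \<open>\<gamma> > 0\<close>, the adjacency matrix is that of the
  de Bruijn graph on \<open>F\<^sup>\<gamma>\<close>, each edge being labelled by the weight of its output. A conjugating permutation
  is an automorphism of this graph that fixes the zero state, hence the identity. So the two
  linear maps \<open>(x, u) \<mapsto> xC + uD\<close> have the same weight function, and Fourier inversion over \<open>F\<^sub>2\<close>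
  recovers from it the multiset of their columns: the generator matrices, and with them the codes
  and their duals, differ by a permutation of the coordinates, which leaves adjacency matrices unchanged.
\<close>

section \<open>Permutations of the coordinates\<close>

text \<open>Why such an automorphism is trivial: in a shift register the zero state can be reached
  from \<open>x\<close> in \<gamma> - k steps exactly when the first k coordinates of
  \<open>x\<close> vanish. Distances to the fixed zero state therefore tell whether coordinate 0
  vanishes, and predecessors carry this over to the other coordinates. What is recovered is the zero
  pattern of a state, and over F_2 this is the state itself. Two places need separate care. The
  adjacency matrix omits the loop of weight 0 at the zero state, so this edge has to be restored
  before the graph can be read off. For \<gamma> = 0 both inputs label the same loop, and only a
  nonzero weight can be attributed to an input. The generalized adjacency matrix is the value of a
  choice operator. For the two given codes the choice is opened, which calls for a minimal generator
  matrix and for a proof that every generator matrix has one row. For the duals it stays closed: a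
  permutation of the coordinates makes the same classes available to both, so the same one is
  chosen.\<close>

definition permute_cols :: "(nat \<Rightarrow> nat) \<Rightarrow> 'a mat \<Rightarrow> 'a mat" where
  "permute_cols \<sigma> M = mat (dim_row M) (dim_col M) (\<lambda>(i, j). M $$ (i, \<sigma> j))"

definition permute_coords :: "(nat \<Rightarrow> nat) \<Rightarrow> 'a vec \<Rightarrow> 'a vec" where
  "permute_coords \<sigma> v = vec (dim_vec v) (\<lambda>j. v $ \<sigma> j)"

lemma permutes_lessThan_lt: "\<sigma> permutes {..<n} \<Longrightarrow> j < n \<Longrightarrow> \<sigma> j < (n::nat)"
  using permutes_in_image[of \<sigma> "{..<n}" j] by simp

lemma dim_permute_cols [simp]:
  "dim_row (permute_cols \<sigma> M) = dim_row M" "dim_col (permute_cols \<sigma> M) = dim_col M"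
  by (simp_all add: permute_cols_def)

lemma index_permute_cols [simp]:
  "i < dim_row M \<Longrightarrow> j < dim_col M \<Longrightarrow> permute_cols \<sigma> M $$ (i, j) = M $$ (i, \<sigma> j)"
  by (simp add: permute_cols_def)

lemma dim_permute_coords [simp]: "dim_vec (permute_coords \<sigma> v) = dim_vec v"
  by (simp add: permute_coords_def)

lemma index_permute_coords [simp]:
  "j < dim_vec v \<Longrightarrow> permute_coords \<sigma> v $ j = v $ \<sigma> j"
  by (simp add: permute_coords_def)

lemma permute_coords_inverse:
  assumes "\<sigma> permutes {..<n}" "dim_vec v = n"
  shows "permute_coords (inv_into UNIV \<sigma>) (permute_coords \<sigma> v) = v"
    and "permute_coords \<sigma> (permute_coords (inv_into UNIV \<sigma>) v) = v"
  using assms permutes_lessThan_lt[OF assms(1)] permutes_lessThan_lt[OF permutes_inv[OF assms(1)]]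
  by (auto intro!: eq_vecI simp: permutes_inverses[OF assms(1)])

lemma permute_coords_add:
  assumes "\<sigma> permutes {..<n}" "dim_vec v = n" "dim_vec w = n"
  shows "permute_coords \<sigma> (v + w) = permute_coords \<sigma> v + permute_coords \<sigma> w"
  using assms permutes_lessThan_lt[OF assms(1)] by (intro eq_vecI) auto

lemma row_mult_permute_cols:
  assumes "\<sigma> permutes {..<dim_col M}"
  shows "u \<^bold>* permute_cols \<sigma> M = permute_coords \<sigma> (u \<^bold>* M)"
proof (rule eq_vecI)
  fix j assume "j < dim_vec (permute_coords \<sigma> (u \<^bold>* M))"
  hence j: "j < dim_col M" by simp
  have "col (permute_cols \<sigma> M) j = col M (\<sigma> j)"
    using j permutes_lessThan_lt[OF assms j] by (intro eq_vecI) auto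
  thus "(u \<^bold>* permute_cols \<sigma> M) $ j = permute_coords \<sigma> (u \<^bold>* M) $ j"
    using j permutes_lessThan_lt[OF assms j] by simp
qed simp

lemma map_mat_permute_cols:
  assumes "\<sigma> permutes {..<dim_col M}"
  shows "map_mat f (permute_cols \<sigma> M) = permute_cols \<sigma> (map_mat f M)"
  using permutes_lessThan_lt[OF assms] by (intro eq_matI) auto

lemma scalar_prod_permute_coords:
  assumes "\<sigma> permutes {..<n}" "dim_vec v = n" "dim_vec w = n"
  shows "permute_coords \<sigma> v \<bullet> permute_coords \<sigma> w = v \<bullet> w"
proof -
  have "permute_coords \<sigma> v \<bullet> permute_coords \<sigma> w = (\<Sum>j<n. v $ \<sigma> j * w $ \<sigma> j)"
    using assms by (simp add: scalar_prod_def atLeast0LessThan)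
  also have "\<dots> = (\<Sum>j<n. v $ j * w $ j)"
    using sum.permute[OF assms(1), of "\<lambda>j. v $ j * w $ j"] by (simp add: comp_def)
  finally show ?thesis using assms by (simp add: scalar_prod_def atLeast0LessThan)
qed

lemma hamming_weight_permute_coords:
  assumes "\<sigma> permutes {..<dim_vec v}"
  shows "hamming_weight (permute_coords \<sigma> v) = hamming_weight v"
proof -
  have "bij_betw \<sigma> {i. i < dim_vec v \<and> permute_coords \<sigma> v $ i \<noteq> 0} {i. i < dim_vec v \<and> v $ i \<noteq> 0}"
    using permutes_lessThan_lt[OF assms] permutes_lessThan_lt[OF permutes_inv[OF assms]]
    by (intro bij_betw_byWitness[where f' = "inv_into UNIV \<sigma>"]) (auto simp: permutes_inverses[OF assms])
  thus ?thesis by (auto simp: hamming_weight_def dest: bij_betw_same_card)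
qed

section \<open>Minors, degrees and minimality under a permutation of the columns\<close>

lemma det_permute_cols:
  assumes "A \<in> carrier_mat n n" "p permutes {..<n}"
  shows "det (permute_cols p A) = signof p * det A"
proof -
  have p: "p permutes {0..<n}" using assms(2) by (simp add: atLeast0LessThan)
  have "transpose_mat (permute_cols p A) = mat n n (\<lambda>(i, j). transpose_mat A $$ (p i, j))"
    using assms(1) permutes_lessThan_lt[OF assms(2)] by (intro eq_matI) auto
  hence "det (transpose_mat (permute_cols p A)) = signof p * det (transpose_mat A)"
    using det_permute_rows[of "transpose_mat A" n p] assms(1) p by simp
  moreover have "permute_cols p A \<in> carrier_mat n n" using assms(1) by auto
  ultimately show ?thesis using assms(1) by (simp add: det_transpose)
qed

text \<open>\<open>submatrix\<close> lists the selected columns through \<open>pick\<close>, in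
  increasing order. Injectivity holds because the index is recovered from \<open>pick J i\<close> as
  the number of smaller elements of \<open>J\<close>.\<close>

lemma bij_betw_pick:
  assumes "finite J" shows "bij_betw (pick J) {..<card J} J"
proof -
  have "inj_on (pick J) {..<card J}"
    by (rule inj_onI) (metis assms card_pick lessThan_iff)
  moreover have "pick J ` {..<card J} \<subseteq> J" by (auto intro: pick_in_set)
  ultimately show ?thesis
    using assms by (simp add: bij_betw_def card_image card_subset_eq)
qed

text \<open>The chosen columns appear in a different order, so the minors agree up to sign.\<close>

lemma degree_minor_permute_cols:
  fixes G :: "'a :: field poly mat"
  assumes \<sigma>: "\<sigma> permutes {..<dim_col G}" and J: "J \<subseteq> {..<dim_col G}" "card J = dim_row G"
  shows "degree (det (submatrix (permute_cols \<sigma> G) UNIV J)) = degree (det (submatrix G UNIV (\<sigma> ` J)))"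
proof -
  let ?k = "dim_row G" and ?n = "dim_col G"
  define K where "K = \<sigma> ` J"
  have finJ: "finite J" using J finite_subset by blast
  have K: "K \<subseteq> {..<?n}" using J(1) permutes_lessThan_lt[OF \<sigma>] by (auto simp: K_def)
  have cardK: "card K = ?k"
    unfolding K_def using J(2) permutes_inj[OF \<sigma>] by (simp add: card_image inj_on_subset)
  have finK: "finite K" using K finite_subset by blast
  have bJ: "bij_betw (pick J) {..<?k} J" and bK: "bij_betw (pick K) {..<?k} K"
    using bij_betw_pick[OF finJ] bij_betw_pick[OF finK] J(2) cardK by auto
  define q where "q = inv_into {..<?k} (pick K)"
  have bq: "bij_betw q K {..<?k}" unfolding q_def using bK by (rule bij_betw_inv_into)
  have pq: "pick K (q x) = x" if "x \<in> K" for x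
    using that bK unfolding q_def by (simp add: bij_betw_inv_into_right)
  have "bij_betw \<sigma> J K" unfolding K_def by (simp add: bij_betw_def permutes_inj_on[OF \<sigma>])
  hence b: "bij_betw (q \<circ> \<sigma> \<circ> pick J) {..<?k} {..<?k}" using bJ bq by (auto intro: bij_betw_trans)
  \<comment> \<open>The j-th selected column of the permuted matrix is column
    \<open>\<sigma> (pick J j)\<close> of \<open>G\<close>, and \<open>\<tau> j\<close> is its rank
    within \<open>K\<close>. Outside the index range \<tau> is the identity, as
    \<open>permutes\<close> demands.\<close>
  define \<tau> where "\<tau> = (\<lambda>j. if j < ?k then q (\<sigma> (pick J j)) else j)"
  have \<tau>: "\<tau> permutes {..<?k}"
    by (rule bij_imp_permutes) (auto simp: \<tau>_def intro!: bij_betw_cong[THEN iffD1, OF _ b])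
  have cJ: "card {j. j < ?n \<and> j \<in> J} = ?k" and cK: "card {j. j < ?n \<and> j \<in> K} = ?k"
  proof -
    have "{j. j < ?n \<and> j \<in> J} = J" "{j. j < ?n \<and> j \<in> K} = K" using J K by auto
    thus "card {j. j < ?n \<and> j \<in> J} = ?k" "card {j. j < ?n \<and> j \<in> K} = ?k"
      using J cardK by simp_all
  qed
  have sJ: "submatrix (permute_cols \<sigma> G) UNIV J \<in> carrier_mat ?k ?k"
    and sK: "submatrix G UNIV K \<in> carrier_mat ?k ?k"
    by (auto simp: dim_submatrix cJ cK)
  have "submatrix (permute_cols \<sigma> G) UNIV J = permute_cols \<tau> (submatrix G UNIV K)"
  proof (rule eq_matI)
    fix i j
    assume "i < dim_row (permute_cols \<tau> (submatrix G UNIV K))"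
      "j < dim_col (permute_cols \<tau> (submatrix G UNIV K))"
    hence i: "i < ?k" and j: "j < ?k" using sK by auto
    have "pick J j \<in> J" using bJ j by (auto dest: bij_betwE)
    hence pj: "pick J j < ?n" "\<sigma> (pick J j) \<in> K" using J by (auto simp: K_def)
    have "\<tau> j < ?k" using permutes_lessThan_lt[OF \<tau> j] .
    moreover have "pick K (\<tau> j) = \<sigma> (pick J j)" using j pj pq by (simp add: \<tau>_def)
    ultimately show "submatrix (permute_cols \<sigma> G) UNIV J $$ (i, j) =
        permute_cols \<tau> (submatrix G UNIV K) $$ (i, j)"
      using i j pj cJ cK sK by (simp add: submatrix_def pick_UNIV)
  qed (use sJ sK in auto)
  hence "det (submatrix (permute_cols \<sigma> G) UNIV J) = signof \<tau> * det (submatrix G UNIV K)"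
    using det_permute_cols[OF sK \<tau>] by simp
  thus ?thesis unfolding K_def by (simp add: sign_def)
qed

text \<open>The image map of \<sigma> permutes the column sets of size \<open>dim_row G\<close>, so
  both maxima range over the same set of degrees.\<close>

lemma overall_constraint_length_permute_cols:
  fixes G :: "'a :: field poly mat"
  assumes \<sigma>: "\<sigma> permutes {..<dim_col G}"
  shows "overall_constraint_length (permute_cols \<sigma> G) = overall_constraint_length G"
proof -
  let ?S = "{J. J \<subseteq> {..<dim_col G} \<and> card J = dim_row G}"
  have "(`) \<sigma> ` ?S = ?S"
  proof
    show "(`) \<sigma> ` ?S \<subseteq> ?S"
      using permutes_lessThan_lt[OF \<sigma>] permutes_inj[OF \<sigma>] by (fastforce simp: card_image inj_on_subset)
    show "?S \<subseteq> (`) \<sigma> ` ?S"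
    proof
      fix J assume "J \<in> ?S"
      hence "inv_into UNIV \<sigma> ` J \<in> ?S"
        using permutes_lessThan_lt[OF permutes_inv[OF \<sigma>]] permutes_inj[OF permutes_inv[OF \<sigma>]]
        by (fastforce simp: card_image inj_on_subset)
      moreover have "J = \<sigma> ` (inv_into UNIV \<sigma> ` J)" by (simp add: image_image permutes_inverses[OF \<sigma>])
      ultimately show "J \<in> (`) \<sigma> ` ?S" by blast
    qed
  qed
  hence "(\<lambda>J. degree (det (submatrix G UNIV J))) ` ?S =
      (\<lambda>J. degree (det (submatrix G UNIV J))) ` ((`) \<sigma> ` ?S)" by simp
  also have "\<dots> = (\<lambda>J. degree (det (submatrix (permute_cols \<sigma> G) UNIV J))) ` ?S"
    unfolding image_image by (rule image_cong) (auto simp: degree_minor_permute_cols[OF \<sigma>])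
  finally show ?thesis
    by (simp add: overall_constraint_length_def setcompr_eq_image)
qed

lemma row_degree_permute_cols:
  assumes \<sigma>: "\<sigma> permutes {..<dim_col G}" and i: "i < dim_row G"
  shows "row_degree (permute_cols \<sigma> G) i = row_degree G i"
proof -
  have "(\<lambda>j. degree (permute_cols \<sigma> G $$ (i, j))) ` {..<dim_col G} =
      (\<lambda>j. degree (G $$ (i, j))) ` (\<sigma> ` {..<dim_col G})"
    using i by (auto simp: image_image)
  also have "\<dots> = (\<lambda>j. degree (G $$ (i, j))) ` {..<dim_col G}"
    using permutes_image[OF \<sigma>] by simp
  finally show ?thesis
    by (simp add: row_degree_def setcompr_eq_image lessThan_def)
qed

lemma total_row_degree_permute_cols:
  assumes "\<sigma> permutes {..<dim_col G}"
  shows "total_row_degree (permute_cols \<sigma> G) = total_row_degree G"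
  by (simp add: total_row_degree_def row_degree_permute_cols[OF assms])

lemma basic_mat_permute_cols:
  assumes \<sigma>: "\<sigma> permutes {..<dim_col G}" and G: "basic_mat G"
  shows "basic_mat (permute_cols \<sigma> G)"
proof -
  let ?k = "dim_row G" and ?n = "dim_col G"
  obtain H where H: "H \<in> carrier_mat ?n ?k" "G * H = 1\<^sub>m ?k"
    using G by (auto simp: basic_mat_def)
  \<comment> \<open>The rows of the right inverse are permuted along with the columns of
    \<open>G\<close>, so that every entry of the product is the same sum in another order.\<close>
  define H' where "H' = mat ?n ?k (\<lambda>(i, j). H $$ (\<sigma> i, j))"
  have "permute_cols \<sigma> G * H' = G * H"
  proof (rule eq_matI)
    fix i j assume "i < dim_row (G * H)" "j < dim_col (G * H)"
    hence ij: "i < ?k" "j < ?k" using H(1) by auto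
    have "row (permute_cols \<sigma> G) i = permute_coords \<sigma> (row G i)"
      "col H' j = permute_coords \<sigma> (col H j)"
      using ij H(1) permutes_lessThan_lt[OF \<sigma>] by (auto intro!: eq_vecI simp: H'_def)
    thus "(permute_cols \<sigma> G * H') $$ (i, j) = (G * H) $$ (i, j)"
      using ij H(1) scalar_prod_permute_coords[OF \<sigma>, of "row G i" "col H j"]
      by (simp add: H'_def)
  qed (use H(1) in \<open>auto simp: H'_def\<close>)
  moreover have "H' \<in> carrier_mat ?n ?k" by (simp add: H'_def)
  ultimately show ?thesis using H(2) by (auto simp: basic_mat_def)
qed

lemma im_mat_permute_cols:
  assumes "\<sigma> permutes {..<dim_col G}"
  shows "im_mat (permute_cols \<sigma> G) = permute_coords \<sigma> ` im_mat G"
  using assms by (auto simp: im_mat_def map_mat_permute_cols row_mult_permute_cols)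

lemma minimal_generator_matrix_permute_cols:
  fixes G :: "'a :: field poly mat"
  assumes "\<sigma> permutes {..<dim_col G}" "minimal_generator_matrix G C"
  shows "minimal_generator_matrix (permute_cols \<sigma> G) (permute_coords \<sigma> ` C)"
  using assms
  by (simp add: minimal_generator_matrix_def generator_matrix_def basic_mat_permute_cols
      im_mat_permute_cols total_row_degree_permute_cols overall_constraint_length_permute_cols)

section \<open>The controller form and the adjacency matrix under a permutation of the
  columns\<close>

lemma ccf_A_permute_cols:
  assumes "\<sigma> permutes {..<dim_col G}"
  shows "ccf_A (permute_cols \<sigma> G) = ccf_A G"
  unfolding ccf_A_def
  by (intro arg_cong[where f = diag_block_mat] map_cong) (auto simp: row_degree_permute_cols[OF assms])

lemma ccf_B_permute_cols:
  assumes "\<sigma> permutes {..<dim_col G}"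
  shows "ccf_B (permute_cols \<sigma> G) = ccf_B G"
  unfolding ccf_B_def
  by (intro arg_cong[where f = diag_block_mat] map_cong) (auto simp: row_degree_permute_cols[OF assms])

lemma mat_of_rows_permute_coords:
  assumes "\<sigma> permutes {..<n}" "set rs \<subseteq> carrier_vec n"
  shows "mat_of_rows n (map (permute_coords \<sigma>) rs) = permute_cols \<sigma> (mat_of_rows n rs)"
proof (rule eq_matI)
  fix i j assume "i < dim_row (permute_cols \<sigma> (mat_of_rows n rs))"
    "j < dim_col (permute_cols \<sigma> (mat_of_rows n rs))"
  hence ij: "i < length rs" "j < n" by auto
  moreover have "dim_vec (rs ! i) = n" using assms(2) ij by (metis carrier_vecD nth_mem subsetD)
  ultimately show "mat_of_rows n (map (permute_coords \<sigma>) rs) $$ (i, j) =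
      permute_cols \<sigma> (mat_of_rows n rs) $$ (i, j)"
    using permutes_lessThan_lt[OF assms(1)] by (simp add: mat_of_rows_index)
qed auto

lemma ccf_C_permute_cols:
  assumes \<sigma>: "\<sigma> permutes {..<dim_col G}"
  shows "ccf_C (permute_cols \<sigma> G) = permute_cols \<sigma> (ccf_C G)"
proof -
  define R where "R G i = rows (mat (row_degree G i) (dim_col G) (\<lambda>(\<nu>, j). coeff (G $$ (i, j)) (Suc \<nu>)))"
    for G :: "'a poly mat" and i
  have "R (permute_cols \<sigma> G) i = map (permute_coords \<sigma>) (R G i)" if "i < dim_row G" for i
    using that permutes_lessThan_lt[OF \<sigma>]
    by (auto simp: R_def list_eq_iff_nth_eq row_degree_permute_cols[OF \<sigma>] intro!: eq_vecI)
  hence "concat (map (R (permute_cols \<sigma> G)) [0..<dim_row G]) =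
      map (permute_coords \<sigma>) (concat (map (R G) [0..<dim_row G]))"
    unfolding map_concat map_map by (intro arg_cong[where f = concat] map_cong) auto
  moreover have "set (concat (map (R G) [0..<dim_row G])) \<subseteq> carrier_vec (dim_col G)"
    by (auto simp: R_def rows_def)
  ultimately have "mat_of_rows (dim_col G) (concat (map (R (permute_cols \<sigma> G)) [0..<dim_row G])) =
      permute_cols \<sigma> (mat_of_rows (dim_col G) (concat (map (R G) [0..<dim_row G])))"
    by (simp add: mat_of_rows_permute_coords[OF \<sigma>])
  thus ?thesis unfolding ccf_C_def R_def dim_permute_cols .
qed

lemma dim_col_ccf_C [simp]: "dim_col (ccf_C G) = dim_col G"
  by (simp add: ccf_C_def)

lemma dim_ccf_D [simp]: "dim_row (ccf_D G) = dim_row G" "dim_col (ccf_D G) = dim_col G"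
  by (simp_all add: ccf_D_def)

text \<open>The transitions depend on \<open>G\<close> only through its row degrees, and the outputs
  undergo a permutation that the weight does not see. Hence the matrices are equal for the same
  ordering \<open>X\<close>, not merely conjugate.\<close>

lemma adjacency_matrix_permute_cols:
  assumes \<sigma>: "\<sigma> permutes {..<dim_col G}"
  shows "adjacency_matrix (permute_cols \<sigma> G) X = adjacency_matrix G X"
proof -
  have "hamming_weight (x \<^bold>* ccf_C (permute_cols \<sigma> G) + u \<^bold>* ccf_D (permute_cols \<sigma> G)) =
      hamming_weight (x \<^bold>* ccf_C G + u \<^bold>* ccf_D G)" for x u
  proof -
    have "ccf_D (permute_cols \<sigma> G) = permute_cols \<sigma> (ccf_D G)"
      using \<sigma> by (simp add: ccf_D_def map_mat_permute_cols)
    hence "x \<^bold>* ccf_C (permute_cols \<sigma> G) + u \<^bold>* ccf_D (permute_cols \<sigma> G) =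
        permute_coords \<sigma> (x \<^bold>* ccf_C G + u \<^bold>* ccf_D G)"
      using \<sigma> by (simp add: ccf_C_permute_cols row_mult_permute_cols permute_coords_add)
    thus ?thesis using \<sigma> by (simp add: hamming_weight_permute_coords)
  qed
  hence "transition_count (permute_cols \<sigma> G) X = transition_count G X"
    unfolding transition_count_def ccf_A_permute_cols[OF \<sigma>] ccf_B_permute_cols[OF \<sigma>]
      dim_permute_cols by presburger
  thus ?thesis by (simp add: adjacency_matrix_def total_row_degree_permute_cols[OF \<sigma>])
qed

section \<open>Codes, their generalized adjacency matrices and their duals under a permutation of
  the coordinates\<close>

lemma im_mat_carrier: "im_mat G \<subseteq> carrier_vec (dim_col G)"
  by (auto simp: im_mat_def intro!: carrier_vecI)

text \<open>The length of a codeword is the number of columns, and the zero input supplies a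
  codeword even when the matrix has no rows.\<close>

lemma generator_matrix_dim_col:
  assumes "generator_matrix G C" "C \<subseteq> carrier_vec n"
  shows "dim_col G = n"
proof -
  have "0\<^sub>v (dim_row G) \<^bold>* map_mat fls_of_poly G \<in> im_mat G"
    unfolding im_mat_def by (intro CollectI exI[of _ "0\<^sub>v (dim_row G)"] conjI refl zero_carrier_vec)
  hence "dim_vec (0\<^sub>v (dim_row G) \<^bold>* map_mat fls_of_poly G) = n"
    using assms unfolding generator_matrix_def by (intro carrier_vecD) auto
  thus ?thesis by simp
qed

lemma permute_coords_image_carrier:
  "C \<subseteq> carrier_vec n \<Longrightarrow> permute_coords \<sigma> ` C \<subseteq> carrier_vec n"
  unfolding carrier_vec_def by auto

lemma permute_coords_image_inverse:
  assumes "\<sigma> permutes {..<n}" "C \<subseteq> carrier_vec n"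
  shows "permute_coords (inv_into UNIV \<sigma>) ` permute_coords \<sigma> ` C = C"
proof -
  have "permute_coords (inv_into UNIV \<sigma>) (permute_coords \<sigma> v) = v" if "v \<in> C" for v
    using that assms by (intro permute_coords_inverse(1)[OF assms(1)]) auto
  thus ?thesis by (force simp: image_image)
qed

text \<open>Two values of \<open>SOME\<close> agree as soon as the predicates agree: permuting
  columns turns a witness \<open>G\<close> for \<open>C\<close> into one for the permuted code with
  the same \<open>X\<close> and the same class \<open>L\<close>. The argument applies to an
  arbitrary set of vectors of length \<open>n\<close>, and it is the dual to which it is applied in
  the end.\<close>

lemma generalized_adjacency_matrix_permute_coords:
  assumes \<sigma>: "\<sigma> permutes {..<n}" and C: "C \<subseteq> carrier_vec n"
  shows "generalized_adjacency_matrix (permute_coords \<sigma> ` C) = generalized_adjacency_matrix C"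
proof -
  let ?P = "\<lambda>C L. \<exists>G X. minimal_generator_matrix G C \<and> state_ordering (total_row_degree G) X \<and>
        L = perm_conj_class (adjacency_matrix G X)"
  have transfer: "?P (permute_coords \<rho> ` D) L" if D: "?P D L" "\<rho> permutes {..<n}" "D \<subseteq> carrier_vec n"
    for \<rho> D L
  proof -
    obtain G X where G: "minimal_generator_matrix G D" "state_ordering (total_row_degree G) X"
      "L = perm_conj_class (adjacency_matrix G X)" using D(1) by blast
    have "dim_col G = n"
      using G(1) D(3) by (auto simp: minimal_generator_matrix_def intro: generator_matrix_dim_col)
    hence "\<rho> permutes {..<dim_col G}" using D(2) by simp
    thus ?thesis
      using G by (intro exI[of _ "permute_cols \<rho> G"] exI[of _ X])
        (simp add: minimal_generator_matrix_permute_cols total_row_degree_permute_cols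
          adjacency_matrix_permute_cols)
  qed
  \<comment> \<open>The converse direction is \<open>transfer\<close> for the inverse permutation,
    applied to the permuted code.\<close>
  have "?P (permute_coords \<sigma> ` C) L \<longleftrightarrow> ?P C L" for L
    using transfer[OF _ \<sigma> C, of L]
      transfer[OF _ permutes_inv[OF \<sigma>] permute_coords_image_carrier[OF C], of \<sigma> L]
    unfolding permute_coords_image_inverse[OF \<sigma> C] by blast
  thus ?thesis unfolding generalized_adjacency_matrix_def by presburger
qed

text \<open>Permutation matrices are orthogonal: they preserve the scalar product, so the dual is
  moved by the same \<sigma> as the code.\<close>

lemma dual_code_permute_coords:
  assumes \<sigma>: "\<sigma> permutes {..<n}" and C: "C \<subseteq> carrier_vec n"
  shows "dual_code n (permute_coords \<sigma> ` C) = permute_coords \<sigma> ` dual_code n C"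
proof -
  have dimC: "dim_vec v = n" if "v \<in> C" for v using that C by auto
  show ?thesis
  proof
    show "permute_coords \<sigma> ` dual_code n C \<subseteq> dual_code n (permute_coords \<sigma> ` C)"
    proof clarify
      fix w assume w: "w \<in> dual_code n C"
      hence dim: "dim_vec w = n" by (simp add: dual_code_def)
      have "permute_coords \<sigma> v \<bullet> permute_coords \<sigma> w = 0" if "v \<in> C" for v
        using that w scalar_prod_permute_coords[OF \<sigma> dimC[OF that] dim] by (simp add: dual_code_def)
      thus "permute_coords \<sigma> w \<in> dual_code n (permute_coords \<sigma> ` C)"
        using dim by (auto simp: dual_code_def intro: carrier_vecI)
    qed
    show "dual_code n (permute_coords \<sigma> ` C) \<subseteq> permute_coords \<sigma> ` dual_code n C"
    proof
      fix w assume w: "w \<in> dual_code n (permute_coords \<sigma> ` C)"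
      hence dim: "dim_vec w = n" by (simp add: dual_code_def)
      let ?w = "permute_coords (inv_into UNIV \<sigma>) w"
      have ww: "permute_coords \<sigma> ?w = w" using permute_coords_inverse(2)[OF \<sigma> dim] .
      have "v \<bullet> ?w = 0" if "v \<in> C" for v
        using that w scalar_prod_permute_coords[OF \<sigma> dimC[OF that], of ?w] dim
        by (simp add: dual_code_def ww)
      hence "?w \<in> dual_code n C" using dim by (auto simp: dual_code_def intro: carrier_vecI)
      thus "w \<in> permute_coords \<sigma> ` dual_code n C" using ww by (metis imageI)
    qed
  qed
qed

section \<open>Rigidity of the de Bruijn graph\<close>

text \<open>The successor xA + aB of state \<open>x\<close> under input \<open>a\<close> when there
  is a single row. On the empty vector all inputs lead to the same state, which is why \<gamma> = 0
  is exceptional later.\<close>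

definition shift_in :: "'a \<Rightarrow> 'a vec \<Rightarrow> 'a vec" where
  "shift_in a x = vec (dim_vec x) (\<lambda>i. case i of 0 \<Rightarrow> a | Suc m \<Rightarrow> x $ m)"

lemma dim_shift_in [simp]: "dim_vec (shift_in a x) = dim_vec x"
  by (simp add: shift_in_def)

lemma shift_in_carrier [simp]: "shift_in a x \<in> carrier_vec k \<longleftrightarrow> x \<in> carrier_vec k"
  unfolding carrier_vec_def by simp

lemma index_shift_in [simp]:
  "0 < dim_vec x \<Longrightarrow> shift_in a x $ 0 = a"
  "Suc i < dim_vec x \<Longrightarrow> shift_in a x $ Suc i = x $ i"
  by (simp_all add: shift_in_def)

text \<open>More than the zero pattern cannot be preserved over a larger alphabet: a permutation of
  the alphabet that fixes 0, applied to every coordinate, is also an automorphism fixing the zero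
  state.\<close>

lemma de_bruijn_automorphism_zero_iff:
  fixes \<phi> :: "'a :: zero vec \<Rightarrow> 'a vec"
  assumes bij: "bij_betw \<phi> (carrier_vec \<gamma>) (carrier_vec \<gamma>)"
    and zero: "\<phi> (0\<^sub>v \<gamma>) = 0\<^sub>v \<gamma>"
    and edge: "\<And>x y. x \<in> carrier_vec \<gamma> \<Longrightarrow> y \<in> carrier_vec \<gamma> \<Longrightarrow>
      (\<exists>a. \<phi> y = shift_in a (\<phi> x)) \<longleftrightarrow> (\<exists>a. y = shift_in a x)"
    and x: "x \<in> carrier_vec \<gamma>" and i: "i < \<gamma>"
  shows "\<phi> x $ i = 0 \<longleftrightarrow> x $ i = 0"
proof -
  define Z :: "nat \<Rightarrow> 'a vec \<Rightarrow> bool" where "Z k x \<longleftrightarrow> (\<forall>i<k. x $ i = 0)" for k x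
  have \<phi>: "\<phi> x \<in> carrier_vec \<gamma>" if "x \<in> carrier_vec \<gamma>" for x
    using that bij by (blast dest: bij_betwE)
  \<comment> \<open>Shifting in 0 gains one leading zero. Conversely, k + 1 leading zeros of a
    successor contain the first k coordinates of \<open>x\<close>, none of which has been shifted
    out since k < \<gamma>.\<close>
  have Z_step: "Z k x \<longleftrightarrow> (\<exists>y\<in>carrier_vec \<gamma>. (\<exists>a. y = shift_in a x) \<and> Z (Suc k) y)"
    if k: "k < \<gamma>" and x: "x \<in> carrier_vec \<gamma>" for k x
  proof
    assume Z: "Z k x"
    have "Z (Suc k) (shift_in 0 x)"
      unfolding Z_def
    proof (intro allI impI)
      fix i assume "i < Suc k" thus "shift_in 0 x $ i = 0"
        using k x Z by (cases i) (auto simp: Z_def)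
    qed
    thus "\<exists>y\<in>carrier_vec \<gamma>. (\<exists>a. y = shift_in a x) \<and> Z (Suc k) y"
      using x by (intro bexI[of _ "shift_in 0 x"]) auto
  next
    assume "\<exists>y\<in>carrier_vec \<gamma>. (\<exists>a. y = shift_in a x) \<and> Z (Suc k) y"
    then obtain a where Z: "Z (Suc k) (shift_in a x)" by blast
    show "Z k x"
      unfolding Z_def
    proof (intro allI impI)
      fix i assume i: "i < k"
      hence "shift_in a x $ Suc i = 0" using Z by (simp add: Z_def)
      thus "x $ i = 0" using i k x by simp
    qed
  qed
  text \<open>\<open>Z k x\<close> says that the zero state can be reached from \<open>x\<close> in \<open>\<gamma> - k\<close> steps.\<close>
  have Z_iff: "\<forall>x\<in>carrier_vec \<gamma>. Z k (\<phi> x) \<longleftrightarrow> Z k x" if "k \<le> \<gamma>" for k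
    using that
  proof (induction k rule: inc_induct)
    \<comment> \<open>At k = \<gamma> the condition singles out the zero state, which \<phi> fixes
      and, by injectivity, to which it sends nothing else. The induction descends from here.\<close>
    case base
    have "Z \<gamma> x \<longleftrightarrow> x = 0\<^sub>v \<gamma>" if "x \<in> carrier_vec \<gamma>" for x
      using that by (auto simp: Z_def)
    moreover have "\<phi> x = 0\<^sub>v \<gamma> \<longleftrightarrow> x = 0\<^sub>v \<gamma>" if "x \<in> carrier_vec \<gamma>" for x
      using that zero bij_betw_imp_inj_on[OF bij] by (metis inj_onD zero_carrier_vec)
    ultimately show ?case using \<phi> by simp
  next
    case (step k)
    show ?case
    proof
      fix x :: "'a vec" assume x: "x \<in> carrier_vec \<gamma>"
      have "Z k (\<phi> x) \<longleftrightarrow> (\<exists>y\<in>\<phi> ` carrier_vec \<gamma>. (\<exists>a. y = shift_in a (\<phi> x)) \<and> Z (Suc k) y)"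
        unfolding bij_betw_imp_surj_on[OF bij] using Z_step[OF step(2) \<phi>[OF x]] .
      also have "\<dots> \<longleftrightarrow> (\<exists>y\<in>carrier_vec \<gamma>. (\<exists>a. y = shift_in a x) \<and> Z (Suc k) y)"
        using step.IH edge[OF x] by auto
      also have "\<dots> \<longleftrightarrow> Z k x" using Z_step[OF step(2) x] by simp
      finally show "Z k (\<phi> x) \<longleftrightarrow> Z k x" .
    qed
  qed
  show ?thesis using x i
  proof (induction i arbitrary: x)
    case 0
    thus ?case using Z_iff[of 1] by (simp add: Z_def)
  next
    case (Suc i)
    \<comment> \<open>A predecessor of \<open>x\<close>. Its last coordinate is lost in the shift
      and is set to 0. Coordinate \<open>Suc i\<close> of \<open>x\<close> becomes coordinate
      \<open>i\<close> of \<open>p\<close>, where the induction hypothesis applies.\<close>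
    define p where "p = vec \<gamma> (\<lambda>i. if Suc i < \<gamma> then x $ Suc i else 0)"
    have p: "p \<in> carrier_vec \<gamma>" by (simp add: p_def)
    have "x = shift_in (x $ 0) p"
    proof (rule eq_vecI)
      fix j assume "j < dim_vec (shift_in (x $ 0) p)"
      thus "x $ j = shift_in (x $ 0) p $ j"
        by (cases j) (auto simp: p_def)
    qed (use Suc.prems in \<open>simp add: p_def\<close>)
    then obtain a where "\<phi> x = shift_in a (\<phi> p)" using edge[OF p Suc.prems(1)] by blast
    hence "\<phi> x $ Suc i = \<phi> p $ i" using \<phi>[OF p] Suc.prems(2) by simp
    moreover have "p $ i = x $ Suc i" using Suc.prems(2) by (simp add: p_def)
    ultimately show ?case using Suc.IH[OF p] Suc.prems(2) by simp
  qed
qed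

section \<open>Binary matrices with equal weight functions\<close>

text \<open>The nontrivial character of the additive group of F_2, with integer values.\<close>

definition bit_sign :: "bit \<Rightarrow> int" where
  "bit_sign b = (if b = 0 then 1 else - 1)"

lemma bit_sign_add: "bit_sign (a + b) = bit_sign a * bit_sign b"
  by (cases a; cases b) (simp_all add: bit_sign_def)

lemma bit_sign_sum: "bit_sign (sum f S) = (\<Prod>\<nu>\<in>S. bit_sign (f \<nu>))"
proof (induction S rule: infinite_finite_induct)
  case (insert x S)
  thus ?case using bit_sign_add[of "f x" "sum f S"] by (simp del: add_bit_eq_xor)
qed (simp_all add: bit_sign_def)

text \<open>Orthogonality for the characters of F_2^A, which are indexed by the subsets
  \<open>S\<close> of \<open>A\<close>. The sum over all subsets factors into one factor per element
  of \<open>A\<close>, equal to 1 + 1 or 1 - 1.\<close>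

lemma sum_bit_sign_orthogonal:
  assumes "finite A"
  shows "(\<Sum>S\<in>Pow A. bit_sign (sum f S) * bit_sign (sum g S)) =
    (if \<forall>\<nu>\<in>A. g \<nu> = f \<nu> then 2 ^ card A else 0)"
proof -
  have "(\<Sum>S\<in>Pow A. bit_sign (sum f S) * bit_sign (sum g S)) =
      (\<Sum>S\<in>Pow A. (\<Prod>\<nu>\<in>S. bit_sign (f \<nu>) * bit_sign (g \<nu>)) * (\<Prod>\<nu>\<in>A - S. 1))"
    by (simp add: bit_sign_sum prod.distrib)
  also have "\<dots> = (\<Prod>\<nu>\<in>A. bit_sign (f \<nu>) * bit_sign (g \<nu>) + 1)"
    by (rule prod_add[OF assms, symmetric])
  also have "\<dots> = (\<Prod>\<nu>\<in>A. if g \<nu> = f \<nu> then 2 else 0)"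
    by (rule prod.cong) (auto simp: bit_sign_def)
  also have "\<dots> = (if \<forall>\<nu>\<in>A. g \<nu> = f \<nu> then 2 ^ card A else 0)"
    using assms by (auto intro!: prod_zero)
  finally show ?thesis .
qed

lemma sum_bit_sign_eq_weight:
  assumes "finite J"
  shows "(\<Sum>j\<in>J. bit_sign (h j)) = int (card J) - 2 * int (card {j \<in> J. h j \<noteq> 0})"
proof -
  have "(\<Sum>j\<in>J. bit_sign (h j)) = (\<Sum>j\<in>J. 1 - 2 * of_bool (h j \<noteq> 0))"
    by (rule sum.cong) (auto simp: bit_sign_def)
  also have "\<dots> = int (card J) - 2 * int (card {j \<in> J. h j \<noteq> 0})"
    using assms by (simp add: sum_subtractf sum_distrib_left[symmetric] Int_def flip: sum_distrib_left)
  finally show ?thesis .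
qed

text \<open>The MacWilliams extension theorem over F_2 in matrix form: \<open>g j\<close> is column
  j of a matrix with rows indexed by \<open>A\<close>, and \<open>S\<close> selects a sum of rows.
  The weights of all these sums are all character sums over the columns, and their Fourier inverse
  counts how often a given vector \<open>f\<close> occurs as a column.\<close>

lemma equal_weights_imp_permutation:
  fixes g g' :: "'j \<Rightarrow> 'v \<Rightarrow> bit"
  assumes J: "finite J" and A: "finite A"
    and weights: "\<And>S. S \<subseteq> A \<Longrightarrow>
      card {j \<in> J. (\<Sum>\<nu>\<in>S. g j \<nu>) \<noteq> 0} = card {j \<in> J. (\<Sum>\<nu>\<in>S. g' j \<nu>) \<noteq> 0}"
  obtains \<sigma> where "\<sigma> permutes J" "\<forall>j\<in>J. \<forall>\<nu>\<in>A. g' j \<nu> = g (\<sigma> j) \<nu>"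
proof -
  have fourier: "2 ^ card A * int (card {j \<in> J. \<forall>\<nu>\<in>A. g j \<nu> = f \<nu>}) =
      (\<Sum>S\<in>Pow A. bit_sign (sum f S) * (\<Sum>j\<in>J. bit_sign (sum (g j) S)))" for g :: "'j \<Rightarrow> 'v \<Rightarrow> bit" and f
  proof -
    have "(\<Sum>S\<in>Pow A. bit_sign (sum f S) * (\<Sum>j\<in>J. bit_sign (sum (g j) S))) =
        (\<Sum>j\<in>J. \<Sum>S\<in>Pow A. bit_sign (sum f S) * bit_sign (sum (g j) S))"
      by (simp add: sum_distrib_left sum.swap[of _ J])
    also have "\<dots> = (\<Sum>j\<in>J. 2 ^ card A * of_bool (\<forall>\<nu>\<in>A. g j \<nu> = f \<nu>))"
      by (rule sum.cong) (simp_all add: sum_bit_sign_orthogonal[OF A])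
    also have "\<dots> = 2 ^ card A * int (card {j \<in> J. \<forall>\<nu>\<in>A. g j \<nu> = f \<nu>})"
      using J by (simp add: Int_def flip: sum_distrib_left)
    finally show ?thesis ..
  qed
  have card_eq: "card {j \<in> J. \<forall>\<nu>\<in>A. g j \<nu> = f \<nu>} = card {j \<in> J. \<forall>\<nu>\<in>A. g' j \<nu> = f \<nu>}" for f
  proof -
    have "2 ^ card A * int (card {j \<in> J. \<forall>\<nu>\<in>A. g j \<nu> = f \<nu>}) =
        2 ^ card A * int (card {j \<in> J. \<forall>\<nu>\<in>A. g' j \<nu> = f \<nu>})"
      unfolding fourier sum_bit_sign_eq_weight[OF J] using weights
      by (intro sum.cong refl) auto
    thus ?thesis by simp
  qed
  \<comment> \<open>Columns matter only on \<open>A\<close>. Their supports within \<open>A\<close>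
    turn them into values that can be counted in a multiset.\<close>
  define supp where "supp g j = {\<nu> \<in> A. g j \<nu> \<noteq> 0}" for g :: "'j \<Rightarrow> 'v \<Rightarrow> bit" and j
  have "image_mset (supp g') (mset_set J) = image_mset (supp g) (mset_set J)"
  proof (rule multiset_eqI)
    fix T
    have cnt: "count (image_mset (supp g) (mset_set J)) T = card {j \<in> J. supp g j = T}" for g
      using J by (simp add: count_image_mset vimage_def Int_def conj_commute)
    show "count (image_mset (supp g') (mset_set J)) T = count (image_mset (supp g) (mset_set J)) T"
    proof (cases "T \<subseteq> A")
      case True
      have "supp g j = T \<longleftrightarrow> (\<forall>\<nu>\<in>A. g j \<nu> = of_bool (\<nu> \<in> T))" for g j
        using True by (fastforce simp: supp_def)
      thus ?thesis unfolding cnt by (simp add: card_eq)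
    next
      case False
      hence "{j \<in> J. supp g j = T} = {}" for g by (auto simp: supp_def)
      thus ?thesis unfolding cnt by (simp only:)
    qed
  qed
  then obtain \<sigma> where \<sigma>: "\<sigma> permutes J" "\<forall>j\<in>J. supp g' j = supp g (\<sigma> j)"
    by (rule image_mset_eq_implies_permutes[OF J])
  show thesis
  proof (rule that[OF \<sigma>(1)], intro ballI)
    fix j \<nu> assume "j \<in> J" "\<nu> \<in> A"
    hence "g' j \<nu> \<noteq> 0 \<longleftrightarrow> g (\<sigma> j) \<nu> \<noteq> 0" using \<sigma>(2) by (auto simp: supp_def)
    thus "g' j \<nu> = g (\<sigma> j) \<nu>" by (metis bit_not_zero_iff)
  qed
qed

section \<open>Conjugate adjacency matrices\<close>

text \<open>Turns an equality of classes into a conjugacy of two concrete matrices. The index 0 must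
  exist for the condition on the entry at (0, 0), hence 0 < s.\<close>

lemma perm_conj_class_refl:
  assumes L: "L \<in> carrier_mat s s" and s: "0 < s"
  shows "L \<in> perm_conj_class L"
proof -
  have one: "map_mat (\<lambda>c. [:c:]) (1\<^sub>m s) = (1\<^sub>m s :: rat poly mat)"
    by (intro eq_matI) (auto simp: one_pCons)
  have "(1\<^sub>m s :: rat mat) = mat s s (\<lambda>(i, j). if i = id j then 1 else 0)"
    by (intro eq_matI) auto
  hence "(1\<^sub>m s :: rat mat) \<in> perm_mat_group s"
    using s permutes_id unfolding perm_mat_group_def by (intro CollectI exI[of _ id]) auto
  moreover have "inverts_mat (1\<^sub>m s :: rat mat) (1\<^sub>m s)" by (simp add: inverts_mat_def)
  ultimately show ?thesis
    unfolding perm_conj_class_def using L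
    by (intro CollectI exI[of _ "1\<^sub>m s"] conjI) (auto simp: one)
qed

text \<open>Instead of computing the inverse of \<open>P\<close>, conjugacy is rewritten as L P = P
  L'. At position (\<pi> i, j) the left side picks one entry of \<open>L\<close> and the right side
  one entry of \<open>L'\<close>. The conclusion that \<open>L\<close> has the size of
  \<open>L'\<close> later identifies the two constraint lengths.\<close>

lemma perm_conj_classE:
  assumes L: "L \<in> perm_conj_class L'" and L': "L' \<in> carrier_mat s s" and s: "0 < s"
  obtains \<pi> where "L \<in> carrier_mat s s" "\<pi> permutes {..<s}" "\<pi> 0 = 0"
    "\<And>i j. i < s \<Longrightarrow> j < s \<Longrightarrow> L $$ (\<pi> i, \<pi> j) = L' $$ (i, j)"
proof -
  define lift where "lift = map_mat (\<lambda>c::rat. [:c:])"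
  obtain P Q where LPQ: "L = lift P * L' * lift Q" and P: "P \<in> perm_mat_group s"
    and Q: "Q \<in> carrier_mat s s" and inv: "inverts_mat Q P"
    using L L' unfolding perm_conj_class_def lift_def by auto
  obtain \<pi> where \<pi>: "\<pi> permutes {..<s}" and P_def: "P = mat s s (\<lambda>(i, j). if i = \<pi> j then 1 else 0)"
    and P0: "P $$ (0, 0) = 1"
    using P by (auto simp: perm_mat_group_def)
  have \<pi>0: "\<pi> 0 = 0" using P0 s by (simp add: P_def split: if_splits)
  have Pc: "P \<in> carrier_mat s s" by (simp add: P_def)
  have carr: "lift P \<in> carrier_mat s s" "lift Q \<in> carrier_mat s s" using Pc Q by (auto simp: lift_def)
  have Lc: "L \<in> carrier_mat s s" using LPQ carr L' by auto
  interpret const: semiring_hom "\<lambda>c::rat. [:c:]"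
    by unfold_locales (auto simp: one_pCons)
  have "lift Q * lift P = lift (Q * P)"
    using const.mat_hom_mult[OF Q Pc] by (simp add: lift_def)
  also have "Q * P = 1\<^sub>m s" using inv carrier_matD(1)[OF Q] by (simp add: inverts_mat_def)
  also have "lift (1\<^sub>m s) = 1\<^sub>m s" unfolding lift_def by (rule const.mat_hom_one)
  finally have QP: "lift Q * lift P = 1\<^sub>m s" .
  have "L * lift P = lift P * L' * (lift Q * lift P)"
    unfolding LPQ by (rule assoc_mult_mat[OF mult_carrier_mat[OF carr(1) L'] carr(2) carr(1)])
  also have "\<dots> = lift P * L'"
    unfolding QP by (rule right_mult_one_mat[OF mult_carrier_mat[OF carr(1) L']])
  finally have "L * lift P = lift P * L'" .
  moreover have "(L * lift P) $$ (\<pi> i, j) = L $$ (\<pi> i, \<pi> j)"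
    "(lift P * L') $$ (\<pi> i, j) = L' $$ (i, j)" if ij: "i < s" "j < s" for i j
  proof -
    have \<pi>ij: "\<pi> i < s" "\<pi> j < s" using ij permutes_lessThan_lt[OF \<pi>] by auto
    have "(L * lift P) $$ (\<pi> i, j) = (\<Sum>k<s. L $$ (\<pi> i, k) * lift P $$ (k, j))"
      using Lc carr ij \<pi>ij by (simp add: scalar_prod_def atLeast0LessThan)
    also have "\<dots> = (\<Sum>k<s. if k = \<pi> j then L $$ (\<pi> i, k) else 0)"
      using ij by (intro sum.cong refl) (simp add: lift_def P_def)
    also have "\<dots> = L $$ (\<pi> i, \<pi> j)" using \<pi>ij by simp
    finally show "(L * lift P) $$ (\<pi> i, j) = L $$ (\<pi> i, \<pi> j)" .
    have "(lift P * L') $$ (\<pi> i, j) = (\<Sum>k<s. lift P $$ (\<pi> i, k) * L' $$ (k, j))"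
      using L' carr ij \<pi>ij by (simp add: scalar_prod_def atLeast0LessThan)
    also have "\<dots> = (\<Sum>k<s. if k = i then L' $$ (k, j) else 0)"
      using ij \<pi>ij inj_eq[OF permutes_inj[OF \<pi>]]
      by (intro sum.cong refl) (auto simp: lift_def P_def)
    also have "\<dots> = L' $$ (i, j)" using ij by simp
    finally show "(lift P * L') $$ (\<pi> i, j) = L' $$ (i, j)" .
  qed
  ultimately have "L $$ (\<pi> i, \<pi> j) = L' $$ (i, j)" if "i < s" "j < s" for i j
    using that by metis
  thus thesis using that Lc \<pi> \<pi>0 by blast
qed

section \<open>Encoders with a single input\<close>

text \<open>The weight of xC + aD for a single row, with the block matrices unfolded into
  coefficients.\<close>

definition output_weight :: "'a :: field poly mat \<Rightarrow> 'a \<Rightarrow> 'a vec \<Rightarrow> nat" where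
  "output_weight G a x = card {j. j < dim_col G \<and>
     a * coeff (G $$ (0, j)) 0 + (\<Sum>\<nu><dim_vec x. x $ \<nu> * coeff (G $$ (0, j)) (Suc \<nu>)) \<noteq> 0}"

lemma output_weight_le: "output_weight G a x \<le> dim_col G"
  unfolding output_weight_def by (rule order.trans[OF card_mono[of "{..<dim_col G}"]]) auto

lemma output_weight_0 [simp]: "output_weight G 0 (0\<^sub>v \<gamma>) = 0"
  by (simp add: output_weight_def)

lemma total_row_degree_one_row: "dim_row G = 1 \<Longrightarrow> total_row_degree G = row_degree G 0"
  by (simp add: total_row_degree_def)

lemma ccf_next_state_one_row:
  assumes "dim_row G = 1" "x \<in> carrier_vec (row_degree G 0)" "u \<in> carrier_vec 1"
  shows "x \<^bold>* ccf_A G + u \<^bold>* ccf_B G = shift_in (u $ 0) x"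
proof (rule eq_vecI)
  let ?\<gamma> = "row_degree G 0"
  have A: "ccf_A G = mat ?\<gamma> ?\<gamma> (\<lambda>(\<mu>, \<nu>). if \<nu> = Suc \<mu> then 1 else 0)"
    and B: "ccf_B G = mat 1 ?\<gamma> (\<lambda>(_, \<nu>). if \<nu> = 0 then 1 else 0)"
    using assms(1) by (simp_all add: ccf_A_def ccf_B_def del: diag_block_mat.simps)
  have dim: "dim_vec x = ?\<gamma>" "dim_vec u = 1" using assms by auto
  show "dim_vec (x \<^bold>* ccf_A G + u \<^bold>* ccf_B G) = dim_vec (shift_in (u $ 0) x)"
    using dim by (simp add: B)
  fix i assume "i < dim_vec (shift_in (u $ 0) x)"
  hence i: "i < ?\<gamma>" using dim by simp
  have "(x \<^bold>* ccf_A G + u \<^bold>* ccf_B G) $ i =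
      (\<Sum>\<mu><?\<gamma>. (if i = Suc \<mu> then 1 else 0) * x $ \<mu>) + (if i = 0 then 1 else 0) * u $ 0"
    using i dim by (simp add: A B scalar_prod_def atLeast0LessThan)
  also have "\<dots> = shift_in (u $ 0) x $ i"
    using i dim by (cases i) (simp_all add: if_distrib[of "\<lambda>c. c * _"] cong: if_cong)
  finally show "(x \<^bold>* ccf_A G + u \<^bold>* ccf_B G) $ i = shift_in (u $ 0) x $ i" .
qed

lemma ccf_output_weight_one_row:
  assumes "dim_row G = 1" "x \<in> carrier_vec (row_degree G 0)" "u \<in> carrier_vec 1"
  shows "hamming_weight (x \<^bold>* ccf_C G + u \<^bold>* ccf_D G) = output_weight G (u $ 0) x"
proof -
  let ?\<gamma> = "row_degree G 0" and ?n = "dim_col G"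
  define M where "M = mat ?\<gamma> ?n (\<lambda>(\<nu>, j). coeff (G $$ (0, j)) (Suc \<nu>))"
  have C: "ccf_C G = M"
    using assms(1) mat_of_rows_rows[of M] by (simp add: ccf_C_def M_def)
  have dim: "dim_vec x = ?\<gamma>" "dim_vec u = 1" using assms by auto
  have "(x \<^bold>* ccf_C G + u \<^bold>* ccf_D G) $ j =
      u $ 0 * coeff (G $$ (0, j)) 0 + (\<Sum>\<nu><dim_vec x. x $ \<nu> * coeff (G $$ (0, j)) (Suc \<nu>))"
    if "j < ?n" for j
    using that dim assms(1)
    by (simp add: C M_def ccf_D_def scalar_prod_def atLeast0LessThan mult.commute add.commute)
  thus ?thesis
    unfolding hamming_weight_def output_weight_def
    by (intro arg_cong[where f = card] Collect_cong) auto
qed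

lemma transition_count_one_row:
  fixes G :: "'a :: {field, finite} poly mat"
  assumes G: "dim_row G = 1" and X: "X i \<in> carrier_vec (row_degree G 0)"
  shows "transition_count G X i j \<alpha> = (if i = 0 \<and> j = 0 \<and> \<alpha> = 0 then 0
    else card {a. X j = shift_in a (X i) \<and> output_weight G a (X i) = \<alpha>})"
proof -
  have "bij_betw (\<lambda>u. u $ 0)
      {u \<in> carrier_vec (dim_row G). X j = X i \<^bold>* ccf_A G + u \<^bold>* ccf_B G \<and>
         hamming_weight (X i \<^bold>* ccf_C G + u \<^bold>* ccf_D G) = \<alpha>}
      {a. X j = shift_in a (X i) \<and> output_weight G a (X i) = \<alpha>}"
    by (rule bij_betw_byWitness[where f' = "\<lambda>a. vec 1 (\<lambda>_. a)"])
      (auto simp: G ccf_next_state_one_row[OF G X] ccf_output_weight_one_row[OF G X] intro!: eq_vecI)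
  thus ?thesis by (auto simp: transition_count_def dest: bij_betw_same_card)
qed

text \<open>Weights are compared through the existence of an edge of a given weight. The position
  excluded by \<open>nz\<close> is the one whose count the definition overwrites by 0.\<close>

lemma transition_count_one_row_eq_0:
  fixes G :: "'a :: {field, finite} poly mat"
  assumes G: "dim_row G = 1" and X: "X i \<in> carrier_vec (row_degree G 0)"
    and nz: "\<not> (i = 0 \<and> j = 0 \<and> \<alpha> = 0)"
  shows "transition_count G X i j \<alpha> = 0 \<longleftrightarrow>
    (\<nexists>a. X j = shift_in a (X i) \<and> output_weight G a (X i) = \<alpha>)"
  using nz unfolding transition_count_one_row[where X = X and i = i, OF G X] by auto

lemma adjacency_matrix_carrier:
  fixes G :: "'a :: {field, finite} poly mat"
  shows "adjacency_matrix G X \<in> carrier_mat (CARD('a) ^ total_row_degree G) (CARD('a) ^ total_row_degree G)"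
  by (simp add: adjacency_matrix_def Let_def)

lemma coeff_adjacency_matrix:
  fixes G :: "'a :: {field, finite} poly mat"
  assumes "i < CARD('a) ^ total_row_degree G" "j < CARD('a) ^ total_row_degree G" "\<alpha> \<le> dim_col G"
  shows "coeff (adjacency_matrix G X $$ (i, j)) \<alpha> = of_nat (transition_count G X i j \<alpha>)"
  using assms by (simp add: adjacency_matrix_def Let_def coeff_sum)

lemma CARD_bit: "CARD(bit) = 2"
proof -
  have "(UNIV :: bit set) = {0, 1}" using bit_not_one_iff by auto
  hence "CARD(bit) = card {0, 1 :: bit}" by (rule arg_cong)
  also have "\<dots> = 2" by simp
  finally show ?thesis .
qed

text \<open>Read through the two orderings, \<pi> becomes a map \<phi> on states that preserves
  edges and fixes zero. Over F_2 it is the identity, so equal entries compare the weights of one and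
  the same edge.\<close>

lemma equal_output_weights:
  fixes G G' :: "bit poly mat"
  assumes G: "dim_row G = 1" "row_degree G 0 = \<gamma>" "dim_col G = n"
    and G': "dim_row G' = 1" "row_degree G' 0 = \<gamma>" "dim_col G' = n"
    and X: "state_ordering \<gamma> X" and X': "state_ordering \<gamma> X'"
    and conj: "adjacency_matrix G X \<in> perm_conj_class (adjacency_matrix G' X')"
    and x: "x \<in> carrier_vec \<gamma>"
  shows "output_weight G a x = output_weight G' a x"
proof -
  let ?s = "CARD(bit) ^ \<gamma>"
  have tr: "total_row_degree G = \<gamma>" "total_row_degree G' = \<gamma>"
    using G G' by (simp_all add: total_row_degree_one_row)
  have s: "0 < ?s" by simp
  obtain \<pi> where \<pi>: "\<pi> permutes {..<?s}" "\<pi> 0 = 0"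
    and entries: "\<And>i j. i < ?s \<Longrightarrow> j < ?s \<Longrightarrow>
      adjacency_matrix G X $$ (\<pi> i, \<pi> j) = adjacency_matrix G' X' $$ (i, j)"
    using perm_conj_classE[OF conj _ s] adjacency_matrix_carrier[of G' X'] tr by metis
  have \<pi>_lt: "\<pi> i < ?s" if "i < ?s" for i using permutes_lessThan_lt[OF \<pi>(1) that] .
  have \<pi>_0: "\<pi> i = 0 \<longleftrightarrow> i = 0" for i using inj_eq[OF permutes_inj[OF \<pi>(1)], of i 0] \<pi>(2) by simp
  have bijX: "bij_betw X {..<?s} (carrier_vec \<gamma>)" and X0: "X 0 = 0\<^sub>v \<gamma>"
    and bijX': "bij_betw X' {..<?s} (carrier_vec \<gamma>)" and X'0: "X' 0 = 0\<^sub>v \<gamma>"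
    using X X' by (auto simp: state_ordering_def)
  have Xc: "X i \<in> carrier_vec \<gamma>" "X' i \<in> carrier_vec \<gamma>" if "i < ?s" for i
    using that bijX bijX' by (auto dest: bij_betwE)
  have count_eq: "transition_count G X (\<pi> i) (\<pi> j) \<alpha> = transition_count G' X' i j \<alpha>"
    if "i < ?s" "j < ?s" "\<alpha> \<le> n" for i j \<alpha>
    using that \<pi>_lt entries coeff_adjacency_matrix[of _ G _ \<alpha> X] coeff_adjacency_matrix[of _ G' _ \<alpha> X'] tr G(3) G'(3)
    by (metis of_nat_eq_iff)
  have weighted_edge: "(\<exists>a. X (\<pi> j) = shift_in a (X (\<pi> i)) \<and> output_weight G a (X (\<pi> i)) = \<alpha>) \<longleftrightarrow>
      (\<exists>a. X' j = shift_in a (X' i) \<and> output_weight G' a (X' i) = \<alpha>)"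
    if ij: "i < ?s" "j < ?s" and nz: "\<not> (i = 0 \<and> j = 0 \<and> \<alpha> = 0)" for i j \<alpha>
  proof (cases "\<alpha> \<le> n")
    case True
    have "transition_count G X (\<pi> i) (\<pi> j) \<alpha> = 0 \<longleftrightarrow> transition_count G' X' i j \<alpha> = 0"
      using count_eq[OF ij True] by simp
    thus ?thesis
      using transition_count_one_row_eq_0[OF G(1), of X "\<pi> i" "\<pi> j" \<alpha>]
        transition_count_one_row_eq_0[OF G'(1), of X' i j \<alpha>] Xc \<pi>_lt ij nz G(2) G'(2) \<pi>_0 by auto
  next
    case False
    thus ?thesis using output_weight_le[of G] output_weight_le[of G'] G(3) G'(3) by metis
  qed
  \<comment> \<open>The erased loop: position (0, 0) of the matrix does not show the edge with input
    0, so its existence is supplied on both sides directly.\<close>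
  have zero_edge: "shift_in (0::bit) (0\<^sub>v \<gamma>) = 0\<^sub>v \<gamma>"
    by (rule eq_vecI) (auto simp: shift_in_def split: nat.split)
  have edge: "(\<exists>a. X (\<pi> j) = shift_in a (X (\<pi> i))) \<longleftrightarrow> (\<exists>a. X' j = shift_in a (X' i))"
    if ij: "i < ?s" "j < ?s" for i j
  proof (cases "i = 0 \<and> j = 0")
    case True
    thus ?thesis using zero_edge X0 X'0 \<pi>(2) by metis
  next
    case False
    thus ?thesis using weighted_edge[OF ij] by blast
  qed
  define \<iota> where "\<iota> = inv_into {..<?s} X'"
  have \<iota>: "\<iota> y < ?s" "X' (\<iota> y) = y" if "y \<in> carrier_vec \<gamma>" for y
    using that bij_betwE[OF bij_betw_inv_into[OF bijX']] bij_betw_inv_into_right[OF bijX']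
    by (auto simp: \<iota>_def)
  define \<phi> where "\<phi> = X \<circ> \<pi> \<circ> \<iota>"
  have bij\<phi>: "bij_betw \<phi> (carrier_vec \<gamma>) (carrier_vec \<gamma>)"
    unfolding \<phi>_def \<iota>_def comp_assoc[symmetric]
    by (rule bij_betw_trans[OF bij_betw_inv_into[OF bijX']
          bij_betw_trans[OF permutes_imp_bij[OF \<pi>(1)] bijX]])
  have \<iota>0: "\<iota> (0\<^sub>v \<gamma>) = 0"
    unfolding \<iota>_def using bij_betw_inv_into_left[OF bijX', of 0] X'0 s by simp
  have \<phi>0: "\<phi> (0\<^sub>v \<gamma>) = 0\<^sub>v \<gamma>" using \<iota>0 \<pi>(2) X0 by (simp add: \<phi>_def)
  have "\<phi> y $ i = 0 \<longleftrightarrow> y $ i = 0" if "y \<in> carrier_vec \<gamma>" "i < \<gamma>" for y i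
    using bij\<phi> \<phi>0 _ that
  proof (rule de_bruijn_automorphism_zero_iff)
    fix y z :: "bit vec" assume "y \<in> carrier_vec \<gamma>" "z \<in> carrier_vec \<gamma>"
    thus "(\<exists>a. \<phi> z = shift_in a (\<phi> y)) \<longleftrightarrow> (\<exists>a. z = shift_in a y)"
      using edge[of "\<iota> y" "\<iota> z"] \<iota> by (simp add: \<phi>_def)
  qed
  hence \<phi>_id: "\<phi> y = y" if "y \<in> carrier_vec \<gamma>" for y
    using that bij_betwE[OF bij\<phi>] by (intro eq_vecI) (metis bit_not_zero_iff carrier_vecD, metis carrier_vecD)
  define i where "i = \<iota> x"
  have i: "i < ?s" "X' i = x" "X (\<pi> i) = x"
    using \<iota>[OF x] \<phi>_id[OF x] by (simp_all add: i_def \<phi>_def)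
  show ?thesis
  proof (cases "a = 0 \<and> x = 0\<^sub>v \<gamma>")
    case True
    thus ?thesis by simp
  next
    case False
    define j where "j = \<iota> (shift_in a x)"
    have "shift_in a x \<in> carrier_vec \<gamma>" using x by simp
    hence j: "j < ?s" "X' j = shift_in a x" "X (\<pi> j) = shift_in a x"
      using \<iota> \<phi>_id by (simp_all add: j_def \<phi>_def)
    have weighted: "(\<exists>b. shift_in a x = shift_in b x \<and> output_weight G b x = \<alpha>) \<longleftrightarrow>
        (\<exists>b. shift_in a x = shift_in b x \<and> output_weight G' b x = \<alpha>)"
      if "\<not> (i = 0 \<and> j = 0 \<and> \<alpha> = 0)" for \<alpha>
      using weighted_edge[OF i(1) j(1) that] unfolding i j .
    show ?thesis
    \<comment> \<open>For \<gamma> > 0 coordinate 0 of the successor reveals the input. Hence each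
      edge has one weight, and the loop at zero has input 0, which has already been treated.\<close>
    proof (cases "\<gamma> = 0")
      case \<gamma>: False
      have inj: "shift_in a x = shift_in b x \<longleftrightarrow> a = b" for b
        using index_shift_in(1)[of x] x \<gamma> by (metis carrier_vecD gr0I)
      have "\<not> (i = 0 \<and> j = 0)"
      proof
        assume "i = 0 \<and> j = 0"
        hence "x = 0\<^sub>v \<gamma>" "shift_in a x = shift_in 0 x" using i j X'0 zero_edge by auto
        thus False using inj False by auto
      qed
      thus ?thesis using weighted[of "output_weight G a x"] inj by auto
    next
      case True
      text \<open>For block codes the input is not determined by the successor state, but it is
        determined by a nonzero weight.\<close>
      have x0: "x = 0\<^sub>v \<gamma>" using x True by auto
      hence "a = 1" using False by simp
      have eq: "shift_in a x = shift_in b x" for b using x True by (intro eq_vecI) auto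
      have "b = a \<or> output_weight H b x = 0" for b and H :: "bit poly mat"
        using x0 \<open>a = 1\<close> by (cases b) auto
      hence "output_weight G a x = \<alpha> \<longleftrightarrow> output_weight G' a x = \<alpha>" if "\<alpha> \<noteq> 0" for \<alpha>
        using weighted[of \<alpha>] that eq by metis
      \<comment> \<open>Taking \<alpha> to be whichever weight is nonzero gives equality; otherwise
        both weights are 0.\<close>
      thus ?thesis by metis
    qed
  qed
qed

text \<open>Stacking D on C gives a matrix with \<gamma> + 1 rows whose column j lists the
  coefficients of entry j of \<open>G\<close>. A pair of input and state is a vector in
  F_2^(\<gamma> + 1), encoded as a subset \<open>S\<close> of \<open>{..\<gamma>}\<close>: 0 stands
  for the input and \<open>Suc \<nu>\<close> for state coordinate \<nu>.\<close>

lemma permute_cols_if_equal_output_weights: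
  fixes G G' :: "bit poly mat"
  assumes G: "dim_row G = 1" "row_degree G 0 = \<gamma>" "dim_col G = n"
    and G': "dim_row G' = 1" "row_degree G' 0 = \<gamma>" "dim_col G' = n"
    and weights: "\<And>a x. x \<in> carrier_vec \<gamma> \<Longrightarrow> output_weight G a x = output_weight G' a x"
  obtains \<sigma> where "\<sigma> permutes {..<n}" "G' = permute_cols \<sigma> G"
proof -
  define g where "g G j = coeff (G $$ (0, j))" for G :: "bit poly mat" and j
  have combo: "output_weight G (of_bool (0 \<in> S)) (vec \<gamma> (\<lambda>\<nu>. of_bool (Suc \<nu> \<in> S))) =
      card {j \<in> {..<n}. (\<Sum>\<nu>\<in>S. g G j \<nu>) \<noteq> 0}"
    if S: "S \<subseteq> {..\<gamma>}" and "dim_col G = n" for S G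
  proof -
    have "(\<Sum>\<nu>\<in>S. f \<nu>) = of_bool (0 \<in> S) * f 0 + (\<Sum>\<nu><\<gamma>. of_bool (Suc \<nu> \<in> S) * f (Suc \<nu>))"
      for f :: "nat \<Rightarrow> bit"
    proof -
      have "(\<Sum>\<nu>\<in>S. f \<nu>) = (\<Sum>\<nu>\<le>\<gamma>. if \<nu> \<in> S then f \<nu> else 0)"
        using S by (simp add: sum.If_cases Int_absorb1)
      also have "\<dots> = (\<Sum>\<nu>\<le>\<gamma>. of_bool (\<nu> \<in> S) * f \<nu>)" by (intro sum.cong) auto
      also have "\<dots> = of_bool (0 \<in> S) * f 0 + (\<Sum>\<nu><\<gamma>. of_bool (Suc \<nu> \<in> S) * f (Suc \<nu>))"
        by (rule sum.atMost_shift)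
      finally show ?thesis .
    qed
    thus ?thesis using that(2) by (simp add: output_weight_def g_def)
  qed
  have "card {j \<in> {..<n}. (\<Sum>\<nu>\<in>S. g G j \<nu>) \<noteq> 0} = card {j \<in> {..<n}. (\<Sum>\<nu>\<in>S. g G' j \<nu>) \<noteq> 0}"
    if S: "S \<subseteq> {..\<gamma>}" for S
    using weights[of "vec \<gamma> (\<lambda>\<nu>. of_bool (Suc \<nu> \<in> S))" "of_bool (0 \<in> S)"]
    unfolding combo[OF S G(3)] combo[OF S G'(3)] by simp
  then obtain \<sigma> where \<sigma>: "\<sigma> permutes {..<n}"
    and eq: "\<forall>j\<in>{..<n}. \<forall>\<nu>\<in>{..\<gamma>}. g G' j \<nu> = g G (\<sigma> j) \<nu>"
    by (rule equal_weights_imp_permutation[OF finite_lessThan finite_atMost])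
  \<comment> \<open>The permutation matches coefficients up to \<gamma>; beyond the row degree all
    coefficients vanish, so whole polynomials are matched.\<close>
  have degree: "coeff (G $$ (0, j)) \<nu> = 0"
    if "j < dim_col G" "row_degree G 0 < \<nu>" for G :: "bit poly mat" and j \<nu>
  proof (rule coeff_eq_0)
    have "degree (G $$ (0, j)) \<le> row_degree G 0"
      unfolding row_degree_def using that(1) by (intro Max_ge) auto
    thus "degree (G $$ (0, j)) < \<nu>" using that(2) by simp
  qed
  have "G' = permute_cols \<sigma> G"
  proof (rule eq_matI)
    fix i j assume "i < dim_row (permute_cols \<sigma> G)" "j < dim_col (permute_cols \<sigma> G)"
    hence ij: "i = 0" "j < n" using G by auto
    have \<sigma>j: "\<sigma> j < n" using permutes_lessThan_lt[OF \<sigma> ij(2)] .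
    have "coeff (G' $$ (0, j)) \<nu> = coeff (G $$ (0, \<sigma> j)) \<nu>" for \<nu>
      using eq degree[of j G' \<nu>] degree[of "\<sigma> j" G \<nu>] ij \<sigma>j G G'
      by (cases "\<nu> \<le> \<gamma>") (auto simp: g_def)
    thus "G' $$ (i, j) = permute_cols \<sigma> G $$ (i, j)"
      using ij G by (simp add: poly_eq_iff)
  qed (use G G' in auto)
  thus thesis using that \<sigma> by blast
qed

section \<open>Generator matrices of one-dimensional codes\<close>

interpretation fls_of_poly: semiring_hom "fls_of_poly :: 'a :: field poly \<Rightarrow> 'a fls"
  by unfold_locales
    (simp_all add: fls_of_poly_def fps_of_poly_add fps_of_poly_mult fls_times_fps_to_fls)

text \<open>The polynomial right inverse remains one over Laurent series and acts as a linear
  decoder.\<close>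

lemma basic_mat_fls_right_inverse:
  fixes G :: "'a :: field poly mat"
  assumes "basic_mat G" and G: "G \<in> carrier_mat k n"
  obtains H :: "'a fls mat" where "H \<in> carrier_mat n k"
    "\<And>u. u \<in> carrier_vec k \<Longrightarrow> (u \<^bold>* map_mat fls_of_poly G) \<^bold>* H = u"
proof -
  obtain H where H: "H \<in> carrier_mat n k" "G * H = 1\<^sub>m k"
    using assms by (auto simp: basic_mat_def)
  let ?G = "map_mat fls_of_poly G" and ?H = "map_mat fls_of_poly H"
  have carr: "?G \<in> carrier_mat k n" "?H \<in> carrier_mat n k" using G H by auto
  have "?G * ?H = 1\<^sub>m k"
    using fls_of_poly.mat_hom_mult[OF G H(1)] H(2) by (simp add: fls_of_poly.mat_hom_one)
  hence inv: "transpose_mat ?H * transpose_mat ?G = 1\<^sub>m k"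
    using transpose_mult[OF carr] by simp
  have "(u \<^bold>* ?G) \<^bold>* ?H = u" if "u \<in> carrier_vec k" for u
  proof -
    have "transpose_mat ?H * transpose_mat ?G *\<^sub>v u = (u \<^bold>* ?G) \<^bold>* ?H"
      using carr that by (intro assoc_mult_mat_vec[of _ k n _ k]) auto
    thus ?thesis using inv that by simp
  qed
  thus thesis using that carr(2) by blast
qed

text \<open>The choice operator may return a generator matrix with any number k of rows, so k = 1
  has to be derived from the code. The decoders \<open>H\<close> and \<open>h\<close> take the place
  of dimension theory.\<close>

lemma generator_matrix_one_dim:
  fixes C :: "'a :: field fls vec set"
  assumes C: "convolutional_code n 1 C" and G: "generator_matrix G C"
  shows "G \<in> carrier_mat 1 n"
proof -
  obtain g where g: "g \<in> carrier_mat 1 n" "basic_mat g" "C = im_mat g"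
    using C by (auto simp: convolutional_code_def generator_matrix_def)
  have "C \<subseteq> carrier_vec n" using im_mat_carrier[of g] g by auto
  hence n: "dim_col G = n" by (rule generator_matrix_dim_col[OF G])
  define k where "k = dim_row G"
  have Gc: "G \<in> carrier_mat k n" using n by (auto simp: k_def)
  have basic: "basic_mat G" and im: "im_mat G = im_mat g"
    using G g(3) by (auto simp: generator_matrix_def)
  let ?G = "map_mat fls_of_poly G" and ?g = "map_mat fls_of_poly g"
  obtain H :: "'a fls mat" where H: "H \<in> carrier_mat n k" "\<And>u. u \<in> carrier_vec k \<Longrightarrow> (u \<^bold>* ?G) \<^bold>* H = u"
    using basic_mat_fls_right_inverse[OF basic Gc] by blast
  obtain h :: "'a fls mat" where h: "h \<in> carrier_mat n 1" "\<And>u. u \<in> carrier_vec 1 \<Longrightarrow> (u \<^bold>* ?g) \<^bold>* h = u"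
    using basic_mat_fls_right_inverse[OF g(2,1)] by blast
  have one: "vec 1 (\<lambda>_. 1) \<in> carrier_vec 1" by simp
  have "k \<noteq> 0"
  proof
    assume k: "k = 0"
    have "vec 1 (\<lambda>_. 1) \<^bold>* ?g \<in> im_mat G"
      unfolding im using g(1) one by (auto simp: im_mat_def simp del: One_nat_def)
    then obtain u where u: "u \<in> carrier_vec 0" "vec 1 (\<lambda>_. 1) \<^bold>* ?g = u \<^bold>* ?G"
      using k by (auto simp: im_mat_def k_def)
    have "u \<^bold>* ?G = 0\<^sub>v n" using u(1) Gc k by (intro eq_vecI) (auto simp: scalar_prod_def)
    hence "vec 1 (\<lambda>_. 1) = 0\<^sub>v n \<^bold>* h" using h(2)[OF one] u(2) by simp
    also have "\<dots> = 0\<^sub>v 1" using h(1) by (intro eq_vecI) auto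
    finally have "vec 1 (\<lambda>_. 1 :: 'a fls) $ 0 = 0\<^sub>v 1 $ 0" by (rule arg_cong)
    thus False by simp
  qed
  moreover have "\<not> 2 \<le> k"
  proof
    assume k: "2 \<le> k"
    \<comment> \<open>Every codeword is a multiple of the single row of \<open>g\<close>, so every
      input of \<open>G\<close> is a multiple of what \<open>H\<close> decodes from that row. Two
      distinct unit vectors cannot both be such multiples.\<close>
    define t where "t = (vec 1 (\<lambda>_. 1) \<^bold>* ?g) \<^bold>* H"
    have multiple: "\<exists>a. u = a \<cdot>\<^sub>v t" if u: "u \<in> carrier_vec k" for u
    proof -
      have "u \<^bold>* ?G \<in> im_mat g" using u unfolding im[symmetric] by (auto simp: im_mat_def k_def)
      then obtain v where v: "v \<in> carrier_vec 1" "u \<^bold>* ?G = v \<^bold>* ?g"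
        using g(1) by (auto simp: im_mat_def)
      have "v = v $ 0 \<cdot>\<^sub>v vec 1 (\<lambda>_. 1)" using v(1) by (intro eq_vecI) auto
      hence "u = (v $ 0 \<cdot>\<^sub>v vec 1 (\<lambda>_. 1) \<^bold>* ?g) \<^bold>* H" using H(2)[OF u] v(2) by metis
      also have "v $ 0 \<cdot>\<^sub>v vec 1 (\<lambda>_. 1) \<^bold>* ?g = v $ 0 \<cdot>\<^sub>v (vec 1 (\<lambda>_. 1) \<^bold>* ?g)"
        using g(1) by (intro mult_mat_vec) auto
      also have "(v $ 0 \<cdot>\<^sub>v (vec 1 (\<lambda>_. 1) \<^bold>* ?g)) \<^bold>* H = v $ 0 \<cdot>\<^sub>v t"
        unfolding t_def using g(1) H(1) by (intro mult_mat_vec[of _ k n]) (auto intro!: carrier_vecI)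
      finally show ?thesis by blast
    qed
    have t: "dim_vec t = k" using H(1) by (simp add: t_def)
    obtain a b where ab: "unit_vec k 0 = a \<cdot>\<^sub>v t" "unit_vec k 1 = b \<cdot>\<^sub>v t"
      using multiple[OF unit_vec_carrier] by meson
    have "1 = a * t $ 0" "0 = a * t $ 1" "1 = b * t $ 1"
      using arg_cong[OF ab(1), of "\<lambda>v. vec_index v 0"] arg_cong[OF ab(1), of "\<lambda>v. vec_index v 1"]
        arg_cong[OF ab(2), of "\<lambda>v. vec_index v 1"] k t by auto
    thus False by auto
  qed
  ultimately have "k = 1" by simp
  thus ?thesis using Gc by simp
qed

text \<open>The maximal minors of a single row are its entries, so every one-row generator matrix is
  already minimal.\<close>

lemma minimal_generator_matrix_one_dim_exists:
  assumes "convolutional_code n 1 C"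
  shows "\<exists>G. minimal_generator_matrix G C"
proof -
  obtain G where G: "G \<in> carrier_mat 1 n" "generator_matrix G C"
    using assms by (auto simp: convolutional_code_def)
  have dim: "dim_row G = 1" "dim_col G = n" using G by auto
  have minor: "det (submatrix G UNIV {j}) = G $$ (0, j)" if "j < n" for j
  proof -
    have cols: "{i. i < dim_col G \<and> i \<in> {j}} = {j}" and rows: "{i. i < dim_row G \<and> i \<in> UNIV} = {0}"
      using that dim by auto
    have "pick {j} 0 = j" using pick_in_set_le[of 0 "{j}"] by simp
    hence "submatrix G UNIV {j} = mat 1 1 (\<lambda>_. G $$ (0, j))"
      unfolding submatrix_def cols rows by (intro eq_matI) (auto simp: pick_UNIV)
    thus ?thesis by (simp add: det_single)
  qed
  have "{J. J \<subseteq> {..<n} \<and> card J = 1} = (\<lambda>j. {j}) ` {..<n}"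
    by (auto simp: card_1_singleton_iff)
  hence "(\<lambda>J. degree (det (submatrix G UNIV J))) ` {J. J \<subseteq> {..<n} \<and> card J = 1} =
      (\<lambda>j. degree (G $$ (0, j))) ` {..<n}"
    unfolding image_image using minor by (simp add: image_image)
  hence "overall_constraint_length G = row_degree G 0"
    unfolding overall_constraint_length_def row_degree_def dim setcompr_eq_image
    by (simp add: lessThan_def)
  thus ?thesis using G(2) total_row_degree_one_row[OF dim(1)]
    by (auto simp: minimal_generator_matrix_def)
qed

lemma state_ordering_exists: "\<exists>X :: nat \<Rightarrow> 'a :: {field, finite} vec. state_ordering \<gamma> X"
proof -
  have b: "bij_betw (vec \<gamma>) ({..<\<gamma>} \<rightarrow>\<^sub>E (UNIV :: 'a set)) (carrier_vec \<gamma>)"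
    by (rule bij_betw_byWitness[where f' = "\<lambda>v. restrict (vec_index v) {..<\<gamma>}"])
      (auto simp: fun_eq_iff PiE_def extensional_def intro!: eq_vecI)
  have fin: "finite (carrier_vec \<gamma> :: 'a vec set)"
    using bij_betw_finite[OF b] by (simp add: finite_PiE)
  have card: "card (carrier_vec \<gamma> :: 'a vec set) = CARD('a) ^ \<gamma>"
    using bij_betw_same_card[OF b] by (simp add: card_PiE)
  obtain X :: "nat \<Rightarrow> 'a vec" where X: "bij_betw X {..<CARD('a) ^ \<gamma>} (carrier_vec \<gamma>)"
    using ex_bij_betw_nat_finite[OF fin] card by (auto simp: atLeast0LessThan)
  \<comment> \<open>An arbitrary enumeration becomes a state ordering after index 0 is swapped with
    the index of the zero state.\<close>
  have "0\<^sub>v \<gamma> \<in> X ` {..<CARD('a) ^ \<gamma>}" using bij_betw_imp_surj_on[OF X] by simp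
  then obtain m where m: "m < CARD('a) ^ \<gamma>" "X m = 0\<^sub>v \<gamma>" by auto
  have pos: "0 < CARD('a) ^ \<gamma>" using m(1) by simp
  have "Transposition.transpose 0 m permutes {..<CARD('a) ^ \<gamma>}"
    using m(1) pos by (intro permutes_swap_id) auto
  hence "bij_betw (X \<circ> Transposition.transpose 0 m) {..<CARD('a) ^ \<gamma>} (carrier_vec \<gamma>)"
    by (rule bij_betw_trans[OF permutes_imp_bij X])
  thus ?thesis using m(2) unfolding state_ordering_def
    by (intro exI[of _ "X \<circ> Transposition.transpose 0 m"] conjI) auto
qed

text \<open>Opens the choice operator: since a witness exists, the chosen class comes from an actual
  generator matrix, about which only the code is known beforehand.\<close>

lemma generalized_adjacency_matrix_one_dimE:
  fixes C :: "'a :: {field, finite} fls vec set"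
  assumes C: "convolutional_code n 1 C"
  obtains G X where "dim_row G = 1" "dim_col G = n" "C = im_mat G"
    "state_ordering (row_degree G 0) X"
    "generalized_adjacency_matrix C = perm_conj_class (adjacency_matrix G X)"
proof -
  have "\<exists>L G X. minimal_generator_matrix G C \<and> state_ordering (total_row_degree G) X \<and>
      L = perm_conj_class (adjacency_matrix G X)"
    using minimal_generator_matrix_one_dim_exists[OF C] state_ordering_exists by metis
  from someI_ex[OF this] obtain G X where G: "minimal_generator_matrix G C"
    "state_ordering (total_row_degree G) X"
    "generalized_adjacency_matrix C = perm_conj_class (adjacency_matrix G X)"
    unfolding generalized_adjacency_matrix_def by blast
  have gen: "generator_matrix G C" using G(1) by (simp add: minimal_generator_matrix_def)
  have "G \<in> carrier_mat 1 n" using generator_matrix_one_dim[OF C gen] .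
  thus thesis
    using that[of G X] G gen total_row_degree_one_row[of G] by (auto simp: generator_matrix_def)
qed

theorem corollary5p5:
  fixes C C' :: "bit fls vec set" and n :: nat
  assumes "convolutional_code n 1 C"
    and "convolutional_code n 1 C'"
    and "generalized_adjacency_matrix C = generalized_adjacency_matrix C'"
  shows "generalized_adjacency_matrix (dual_code n C) = generalized_adjacency_matrix (dual_code n C')"
proof -
  obtain G X where G: "dim_row G = 1" "dim_col G = n" "C = im_mat G"
    and X: "state_ordering (row_degree G 0) X"
    and L: "generalized_adjacency_matrix C = perm_conj_class (adjacency_matrix G X)"
    using generalized_adjacency_matrix_one_dimE[OF assms(1)] .
  obtain G' X' where G': "dim_row G' = 1" "dim_col G' = n" "C' = im_mat G'"
    and X': "state_ordering (row_degree G' 0) X'"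
    and L': "generalized_adjacency_matrix C' = perm_conj_class (adjacency_matrix G' X')"
    using generalized_adjacency_matrix_one_dimE[OF assms(2)] .
  have carr: "adjacency_matrix G X \<in> carrier_mat (2 ^ row_degree G 0) (2 ^ row_degree G 0)"
    "adjacency_matrix G' X' \<in> carrier_mat (2 ^ row_degree G' 0) (2 ^ row_degree G' 0)"
    using adjacency_matrix_carrier[of G X] adjacency_matrix_carrier[of G' X'] G(1) G'(1)
    by (simp_all only: total_row_degree_one_row CARD_bit)
  have conj: "adjacency_matrix G X \<in> perm_conj_class (adjacency_matrix G' X')"
    using perm_conj_class_refl[OF carr(1)] assms(3) unfolding L L' by simp
  \<comment> \<open>Conjugate matrices have the same size, and the size 2^\<gamma> determines
    \<gamma>.\<close>
  have "adjacency_matrix G X \<in> carrier_mat (2 ^ row_degree G' 0) (2 ^ row_degree G' 0)"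
    by (rule perm_conj_classE[OF conj carr(2)]) simp_all
  hence "(2::nat) ^ row_degree G 0 = 2 ^ row_degree G' 0"
    using carr(1) by (metis carrier_matD(1))
  hence \<gamma>: "row_degree G' 0 = row_degree G 0" by simp
  obtain \<sigma> where \<sigma>: "\<sigma> permutes {..<n}" "G' = permute_cols \<sigma> G"
    using equal_output_weights[OF G(1) refl G(2) G'(1) \<gamma> G'(2) X X'[unfolded \<gamma>] conj]
    by (rule permute_cols_if_equal_output_weights[OF G(1) refl G(2) G'(1) \<gamma> G'(2)])
  have C: "C \<subseteq> carrier_vec n" using im_mat_carrier[of G] G by simp
  have "C' = permute_coords \<sigma> ` C"
    using \<sigma> G G' by (simp add: im_mat_permute_cols)
  hence "dual_code n C' = permute_coords \<sigma> ` dual_code n C"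
    by (simp add: dual_code_permute_coords[OF \<sigma>(1) C])
  moreover have "dual_code n C \<subseteq> carrier_vec n" by (auto simp: dual_code_def)
  ultimately show ?thesis
    by (simp add: generalized_adjacency_matrix_permute_coords[OF \<sigma>(1)])
qed

end
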